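(* Let $X$ be a compact Riemannian (triangulable) submanifold of $\mathbb{R}^m$ with condition number $1/\tau$, and let $f:\mathbb{R}^m\to\mathbb{R}^n$ be a continuous function with modulus of continuity $\Omega$. Let $0<\delta<\sqrt{3/5}\,\tau$ and let $L=\{l_1,\ldots,l_k\}$ be a finite set of points of $X$ such that for every $p\in X$ there exists $l_j\in L$ with $\|p-l_j\|<\delta/2$. Let $U=\bigcup_{j=1}^k B(l_j,\delta)$ be the union of the closed balls of $\mathbb{R}^m$ of radius $\delta$ centered at the $l_j$. Let $f_X,f_U$ be the restrictions of $f$ to $X$ and $U$, fix $i\in\mathbb{Z}$, and write $\beta_X=\beta_{(X,f_X,i)}$, $\beta_U=\beta_{(U,f_U,i)}$. Put $\omega(\delta)=(\Omega(\delta),\ldots,\Omega(\delta))\in\mathbb{R}^n$. (1) If $(u,v)\in\Delta^+$ and $u+\omega(\delta)\prec v-\omega(\delta)$, then $$\beta_U(u-\omega(\delta),v+\omega(\delta))\le\beta_X(u,v)\le\beta_U(u+\omega(\delta),v-\omega(\delta)).$$ (2) If $(\overline u,\overline v)\in\Delta^+$ is such that $\beta_X(\overline u,\overline v)\neq\beta_U(\overline u,\overline v)$, then there is at least one point $(\tilde u,\tilde v)$ with $\|(\overline u,\overline v)-(\tilde u,\tilde v)\|\le\Omega(\delta)$ in the max norm, which is either an element of the boundary of $\Delta^+$ or a discontinuity point of $\beta_U$.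
   Context: $\mathbb{R}^m$ carries the Euclidean norm; $\mathbb{R}^n$ (codomain of filtering functions) and $\mathbb{R}^n\times\mathbb{R}^n$ carry the max norm. For $u,v\in\mathbb{R}^n$, $u\prec v$ (resp. $u\preceq v$) means $u_j<v_j$ (resp. $u_j\le v_j$) for all $j=1,\ldots,n$. $\Delta^+=\{(u,v)\in\mathbb{R}^n\times\mathbb{R}^n : u\prec v\}$. Persistent Betti numbers: fix a field $\mathbb{K}$. A space is triangulable if it is homeomorphic to the underlying space of a finite simplicial complex (for a submanifold of a Euclidean space, also that its triangulation can be extended to a domain containing it). For a triangulable space $Z$, a continuous $f:Z\to\mathbb{R}^n$ and $i\in\mathbb{Z}$, let $Z\langle f\preceq u\rangle=\{p\in Z: f_j(p)\le u_j,\ j=1,\ldots,n\}$; then $\beta_{(Z,f,i)}:\Delta^+\to\mathbb{N}$ is defined by letting $\beta_{(Z,f,i)}(u,v)$ be the dimension of the image of the homomorphism $\check H_i(Z\langle f\preceq u\rangle)\to\check H_i(Z\langle f\preceq v\rangle)$ induced by inclusion, where $\check H_i$ is the $i$-th Čech homology with coefficients in $\mathbb{K}$. Discontinuity points of $\beta$ are those of the function $\beta:\Delta^+\to\mathbb{N}$ ($\mathbb{N}$ discrete). Modulus of continuity of $f:\mathbb{R}^m\to\mathbb{R}^n$: $\Omega(\varepsilon)=\max_{j}\sup\{|f_j(p)-f_j(p')| : p,p'\in\mathbb{R}^m,\ \|p-p'\|\le\varepsilon\}$. Condition number $1/\tau$: the open normal bundle to $X$ of radius $s$ is $\{(p,w):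 p\in X,\ w\in T_p\mathbb{R}^m \text{ orthogonal to } T_pX,\ \|w\|<s\}$, mapped to $\mathbb{R}^m$ by $(p,w)\mapsto p+w$; $\tau$ is the largest number such that for every $s<\tau$ this map is an embedding. *)

theory Defs
  imports
    "HOL-Analysis.Analysis"
    "HOL-Algebra.Module"
    "HOL-Library.Poly_Mapping"
    "HOL-Library.Extended_Nat"
begin

section \<open>Simplicial homology with field coefficients\<close>

text \<open>
  Chains are finite \<^typ>\<open>'k::field\<close>-combinations of ordered simplices: the ordered
  \<open>q\<close>-simplices of a complex \<open>K\<close> are the lists of \<open>q + 1\<close> vertices, repetitions allowed,
  whose vertices span a simplex of \<open>K\<close>. The degree is an integer; there are no chains in
  negative degrees.
\<close>

definition ord_chains :: "int \<Rightarrow> 'v set set \<Rightarrow> ('v list \<Rightarrow>\<^sub>0 'k::field) set" where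
  "ord_chains q K =
     {c. \<forall>s \<in> Poly_Mapping.keys c. s \<noteq> [] \<and> set s \<in> K \<and> int (length s) = q + 1}"

definition ord_boundary :: "('v list \<Rightarrow>\<^sub>0 'k::field) \<Rightarrow> ('v list \<Rightarrow>\<^sub>0 'k)" where
  "ord_boundary c =
     (\<Sum>s \<in> Poly_Mapping.keys c.
        if length s \<le> 1 then 0
        else \<Sum>j<length s.
          Poly_Mapping.single (take j s @ drop (Suc j) s) ((-1) ^ j * Poly_Mapping.lookup c s))"

definition ord_push :: "('v \<Rightarrow> 'w) \<Rightarrow> ('v list \<Rightarrow>\<^sub>0 'k::field) \<Rightarrow> ('w list \<Rightarrow>\<^sub>0 'k)" where
  "ord_push p c =
     (\<Sum>s \<in> Poly_Mapping.keys c. Poly_Mapping.single (map p s) (Poly_Mapping.lookup c s))"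

definition ord_cycles :: "int \<Rightarrow> 'v set set \<Rightarrow> ('v list \<Rightarrow>\<^sub>0 'k::field) set" where
  "ord_cycles q K = {c \<in> ord_chains q K. ord_boundary c = 0}"

definition ord_boundaries :: "int \<Rightarrow> 'v set set \<Rightarrow> ('v list \<Rightarrow>\<^sub>0 'k::field) set" where
  "ord_boundaries q K = ord_boundary ` ord_chains (q + 1) K"

text \<open>
  The homology vector space, cycles modulo boundaries; its elements are cosets. The fields
  \<open>mult\<close> and \<open>one\<close> of the record type \<open>module\<close> play no role for modules.
\<close>

definition simp_homology ::
    "int \<Rightarrow> 'v set set \<Rightarrow> ('k::field, ('v list \<Rightarrow>\<^sub>0 'k) set) module" where
  "simp_homology q K =
     \<lparr>carrier = (\<lambda>z. (\<lambda>b. z + b) ` ord_boundaries q K) ` ord_cycles q K,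
      mult = undefined, one = undefined,
      zero = ord_boundaries q K,
      add = (\<lambda>A B. {a + b |a b. a \<in> A \<and> b \<in> B}),
      smult = (\<lambda>k A. {Poly_Mapping.map ((*) k) a + b |a b. a \<in> A \<and> b \<in> ord_boundaries q K})\<rparr>"

definition simp_homology_map ::
    "int \<Rightarrow> 'w set set \<Rightarrow> ('v \<Rightarrow> 'w) \<Rightarrow> ('v list \<Rightarrow>\<^sub>0 'k::field) set \<Rightarrow> ('w list \<Rightarrow>\<^sub>0 'k) set" where
  "simp_homology_map q L p A = {ord_push p a + b |a b. a \<in> A \<and> b \<in> ord_boundaries q L}"

section \<open>Cech homology\<close>

definition nerve :: "'a set set \<Rightarrow> 'a set set set" where
  "nerve \<U> = {\<sigma>. finite \<sigma> \<and> \<sigma> \<noteq> {} \<and> \<sigma> \<subseteq> \<U> \<and> \<Inter>\<sigma> \<noteq> {}}"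

definition finite_open_covers :: "'a topology \<Rightarrow> 'a set set set" where
  "finite_open_covers T = {\<U>. finite \<U> \<and> (\<forall>U\<in>\<U>. openin T U) \<and> \<Union>\<U> = topspace T}"

text \<open>
  If \<open>g\<close> carries every member of \<open>\<U>\<close> into some member of \<open>\<V>\<close>, a choice of such members is a
  simplicial map between the nerves. Any two choices are contiguous, so the induced map on
  homology does not depend on the one taken by \<open>SOME\<close>.
\<close>

definition nerve_homology_map ::
    "int \<Rightarrow> ('a \<Rightarrow> 'b) \<Rightarrow> 'a set set \<Rightarrow> 'b set set
      \<Rightarrow> ('a set list \<Rightarrow>\<^sub>0 'k::field) set \<Rightarrow> ('b set list \<Rightarrow>\<^sub>0 'k) set" where
  "nerve_homology_map q g \<U> \<V> =
     simp_homology_map q (nerve \<V>) (SOME p. \<forall>U\<in>\<U>. p U \<in> \<V> \<and> g ` U \<subseteq> p U)"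

text \<open>
  The inverse limit of the homology of the nerves over all finite open covers, directed by
  refinement. Finite covers are cofinal among all open covers when the space is compact.
\<close>

definition cech_homology ::
    "int \<Rightarrow> 'a topology \<Rightarrow> ('k::field, 'a set set \<Rightarrow> ('a set list \<Rightarrow>\<^sub>0 'k) set) module" where
  "cech_homology q T =
     \<lparr>carrier =
        {x \<in> (\<Pi>\<^sub>E \<U> \<in> finite_open_covers T. carrier (simp_homology q (nerve \<U>))).
           \<forall>\<U> \<in> finite_open_covers T. \<forall>\<V> \<in> finite_open_covers T.
             (\<forall>U\<in>\<U>. \<exists>V\<in>\<V>. U \<subseteq> V) \<longrightarrow> nerve_homology_map q id \<U> \<V> (x \<U>) = x \<V>},
      mult = undefined, one = undefined,
      zero = (\<lambda>\<U> \<in> finite_open_covers T. \<zero>\<^bsub>simp_homology q (nerve \<U>)\<^esub>),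
      add = (\<lambda>x y. \<lambda>\<U> \<in> finite_open_covers T. x \<U> \<oplus>\<^bsub>simp_homology q (nerve \<U>)\<^esub> y \<U>),
      smult = (\<lambda>k x. \<lambda>\<U> \<in> finite_open_covers T. k \<odot>\<^bsub>simp_homology q (nerve \<U>)\<^esub> x \<U>)\<rparr>"

definition cover_pullback :: "'a topology \<Rightarrow> ('a \<Rightarrow> 'b) \<Rightarrow> 'b set set \<Rightarrow> 'a set set" where
  "cover_pullback S g \<V> = (\<lambda>V. {x \<in> topspace S. g x \<in> V}) ` \<V>"

definition cech_map ::
    "int \<Rightarrow> 'a topology \<Rightarrow> 'b topology \<Rightarrow> ('a \<Rightarrow> 'b)
      \<Rightarrow> ('a set set \<Rightarrow> ('a set list \<Rightarrow>\<^sub>0 'k::field) set) \<Rightarrow> 'b set set \<Rightarrow> ('b set list \<Rightarrow>\<^sub>0 'k) set" where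
  "cech_map q S T g x =
     (\<lambda>\<V> \<in> finite_open_covers T.
        nerve_homology_map q g (cover_pullback S g \<V>) \<V> (x (cover_pullback S g \<V>)))"

section \<open>Persistent Betti numbers\<close>

definition lin_indep_in :: "('k::field, 'm) module \<Rightarrow> 'm set \<Rightarrow> bool" where
  "lin_indep_in M S \<longleftrightarrow>
     S \<subseteq> carrier M \<and> finite S \<and>
     (\<forall>a. (\<Oplus>\<^bsub>M\<^esub>x\<in>S. a x \<odot>\<^bsub>M\<^esub> x) = \<zero>\<^bsub>M\<^esub> \<longrightarrow> (\<forall>x\<in>S. a x = 0))"

text \<open>
  The dimension of a linear subspace \<open>W\<close> of \<open>M\<close>. It is \<open>\<infinity>\<close>, not a default natural number, if
  \<open>W\<close> is not finite-dimensional.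
\<close>

definition subspace_dim :: "('k::field, 'm) module \<Rightarrow> 'm set \<Rightarrow> enat" where
  "subspace_dim M W = (SUP S \<in> {S. S \<subseteq> W \<and> lin_indep_in M S}. enat (card S))"

definition vprec :: "real^'n \<Rightarrow> real^'n \<Rightarrow> bool" (infix "\<prec>" 50) where
  "u \<prec> v \<longleftrightarrow> (\<forall>j. u $ j < v $ j)"

definition vpreceq :: "real^'n \<Rightarrow> real^'n \<Rightarrow> bool" (infix "\<preceq>" 50) where
  "u \<preceq> v \<longleftrightarrow> (\<forall>j. u $ j \<le> v $ j)"

definition Delta_plus :: "((real^'n) \<times> (real^'n)) set" where
  "Delta_plus = {(u, v). u \<prec> v}"

definition sublevel :: "'a set \<Rightarrow> ('a \<Rightarrow> real^'n) \<Rightarrow> real^'n \<Rightarrow> 'a set" where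
  "sublevel Z f u = {p \<in> Z. f p \<preceq> u}"

text \<open>
  The type argument is the coefficient field. Only the restriction of \<open>f\<close> to \<open>Z\<close> matters.
  For triangulable \<open>Z\<close> and \<open>f\<close> continuous on \<open>Z\<close> the values on \<^const>\<open>Delta_plus\<close> are finite.
\<close>

definition pers_betti ::
    "'k::field itself \<Rightarrow> int \<Rightarrow> 'a::topological_space set \<Rightarrow> ('a \<Rightarrow> real^'n)
      \<Rightarrow> (real^'n) \<times> (real^'n) \<Rightarrow> enat" where
  "pers_betti _ i Z f = (\<lambda>(u, v).
     let A = top_of_set (sublevel Z f u); B = top_of_set (sublevel Z f v)
     in subspace_dim (cech_homology i B :: ('k, 'a set set \<Rightarrow> ('a set list \<Rightarrow>\<^sub>0 'k) set) module)
          (cech_map i A B id ` carrier (cech_homology i A)))"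

definition discontinuity_point ::
    "((real^'n) \<times> (real^'n) \<Rightarrow> enat) \<Rightarrow> (real^'n) \<times> (real^'n) \<Rightarrow> bool" where
  "discontinuity_point b w \<longleftrightarrow>
     w \<in> Delta_plus \<and> \<not> topcontinuous_at (top_of_set Delta_plus) (discrete_topology UNIV) b w"

section \<open>Submanifolds of Euclidean spaces\<close>

fun ck_on :: "nat \<Rightarrow> 'a::real_normed_vector set \<Rightarrow> ('a \<Rightarrow> 'b::real_normed_vector) \<Rightarrow> bool" where
  "ck_on 0 S f \<longleftrightarrow> continuous_on S f"
| "ck_on (Suc k) S f \<longleftrightarrow>
     (\<forall>x\<in>S. f differentiable (at x)) \<and> (\<forall>v. ck_on k S (\<lambda>x. frechet_derivative f (at x) v))"

text \<open>Meant for open \<open>S\<close> in a finite-dimensional domain.\<close>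

definition smooth_on :: "'a::real_normed_vector set \<Rightarrow> ('a \<Rightarrow> 'b::real_normed_vector) \<Rightarrow> bool" where
  "smooth_on S f \<longleftrightarrow> (\<forall>k. ck_on k S f)"

definition smooth_submanifold :: "'a::euclidean_space set \<Rightarrow> bool" where
  "smooth_submanifold X \<longleftrightarrow>
     (\<exists>d. \<forall>p\<in>X. \<exists>W V \<phi> \<psi> E.
        open W \<and> p \<in> W \<and> open V \<and> homeomorphism W V \<phi> \<psi> \<and> smooth_on W \<phi> \<and> smooth_on V \<psi> \<and>
        subspace E \<and> dim E = d \<and> \<phi> ` (X \<inter> W) = V \<inter> (E :: 'a set))"

definition tangent_space :: "'a::euclidean_space set \<Rightarrow> 'a \<Rightarrow> 'a set" where
  "tangent_space X p =
     {\<xi>. \<exists>(\<gamma> :: real \<Rightarrow> 'a) e. e > 0 \<and> smooth_on {-e<..<e} \<gamma> \<and> \<gamma> ` {-e<..<e} \<subseteq> X \<and> \<gamma> 0 = p \<and>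
          (\<gamma> has_vector_derivative \<xi>) (at 0)}"

definition smooth_embedding_on ::
    "'a::euclidean_space set \<Rightarrow> ('a \<Rightarrow> 'b::euclidean_space) \<Rightarrow> bool" where
  "smooth_embedding_on M g \<longleftrightarrow>
     (\<exists>W. open W \<and> M \<subseteq> W \<and> smooth_on W g) \<and>
     (\<forall>x\<in>M. inj_on (frechet_derivative g (at x)) (tangent_space M x)) \<and>
     (\<exists>h. homeomorphism M (g ` M) g h)"

definition normal_bundle :: "'a::euclidean_space set \<Rightarrow> real \<Rightarrow> ('a \<times> 'a) set" where
  "normal_bundle X s = {(p, w). p \<in> X \<and> (\<forall>\<xi> \<in> tangent_space X p. w \<bullet> \<xi> = 0) \<and> norm w < s}"

definition normal_bundle_embedded_below :: "'a::euclidean_space set \<Rightarrow> real \<Rightarrow> bool" where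
  "normal_bundle_embedded_below X t \<longleftrightarrow>
     (\<forall>s<t. smooth_embedding_on (normal_bundle X s) (\<lambda>(p, w). p + w))"

definition has_condition_number :: "'a::euclidean_space set \<Rightarrow> real \<Rightarrow> bool" where
  "has_condition_number X c \<longleftrightarrow>
     (\<exists>\<tau>>0. c = 1 / \<tau> \<and> normal_bundle_embedded_below X \<tau> \<and>
        (\<forall>t. normal_bundle_embedded_below X t \<longrightarrow> t \<le> \<tau>))"

text \<open>
  A triangulation of \<open>X\<close> by a finite complex \<open>\<L>\<close> that extends to a triangulation \<open>\<K>\<close> of (the
  closure of) a domain containing \<open>X\<close>. If \<open>'a\<close> has dimension \<open>m\<close>, such complexes have dimension
  at most \<open>m\<close> and hence can be realised in dimension \<open>2 m + 1\<close>, which is why requiring them to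
  lie in \<open>'a \<times> 'a \<times> real\<close> is no restriction.
\<close>

definition triangulable_submanifold :: "'a::euclidean_space set \<Rightarrow> bool" where
  "triangulable_submanifold X \<longleftrightarrow>
     (\<exists>(\<K> :: ('a \<times> 'a \<times> real) set set) \<L> W h g.
        simplicial_complex \<K> \<and> simplicial_complex \<L> \<and> \<L> \<subseteq> \<K> \<and>
        open W \<and> connected W \<and> X \<subseteq> W \<and>
        homeomorphism (\<Union>\<K>) (closure W) h g \<and> h ` (\<Union>\<L>) = X)"

section \<open>Modulus of continuity\<close>

text \<open>
  \<open>\<Omega>\<close> is real-valued, so the suprema have to be finite.
\<close>

definition has_modulus_of_continuity ::
    "('a::real_normed_vector \<Rightarrow> real^'n) \<Rightarrow> (real \<Rightarrow> real) \<Rightarrow> bool" where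
  "has_modulus_of_continuity f \<Omega> \<longleftrightarrow>
     (\<forall>\<epsilon>\<ge>0.
        (\<forall>j. bdd_above {\<bar>f p $ j - f p' $ j\<bar> |p p'. norm (p - p') \<le> \<epsilon>}) \<and>
        \<Omega> \<epsilon> = Max (range (\<lambda>j. Sup {\<bar>f p $ j - f p' $ j\<bar> |p p'. norm (p - p') \<le> \<epsilon>})))"

end

theory Submission
  imports Defs
begin

text \<open>
  Below the condition number the normal bundle embeds, so every point of \<open>U\<close> has a unique nearest
  point in \<open>X\<close>; this gives a retraction \<open>\<pi>\<close> of \<open>U\<close> onto \<open>X\<close> moving points by at most \<open>\<delta>\<close>.
  Open balls of radius \<open>\<tau>\<close> tangent to \<open>X\<close> miss \<open>X\<close>, and an elementary estimate then keeps the
  segment from \<open>p\<close> to \<open>\<pi> p\<close> inside \<open>U\<close>. Since \<open>f\<close> changes by at most \<open>\<Omega> \<delta>\<close> along such segments,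
  the inclusions of sublevel sets of \<open>U\<close> factor, up to a shift by \<open>\<omega>\<close> and a homotopy, through those
  of \<open>X\<close>, and vice versa; comparing ranks gives (1).

  Homotopy invariance of Cech homology needs no prism over the space: two maps
  closer than a Lebesgue number of a cover \<open>\<V>\<close> carry a common cover into \<open>\<V>\<close> by one choice of
  members, hence agree at \<open>\<V>\<close>, and a homotopy between compact spaces is cut into such small steps.

  For (2), the closed max-norm ball of radius \<open>\<Omega> \<delta>\<close> is connected. If it contains neither a boundary
  point of \<^const>\<open>Delta_plus\<close> nor a discontinuity, \<open>\<beta>\<^sub>U\<close> is constant on it, and (1) squeezes
  \<open>\<beta>\<^sub>X\<close> between two of its values.
\<close>

section \<open>Chains\<close>

abbreviation scale :: "'k::field \<Rightarrow> ('v \<Rightarrow>\<^sub>0 'k) \<Rightarrow> ('v \<Rightarrow>\<^sub>0 'k)" where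
  "scale k c \<equiv> Poly_Mapping.map ((*) k) c"

abbreviation basis_chain :: "'v \<Rightarrow> ('v \<Rightarrow>\<^sub>0 'k::field)" where
  "basis_chain s \<equiv> Poly_Mapping.single s 1"

lemma lookup_scale: "Poly_Mapping.lookup (scale k c) s = k * Poly_Mapping.lookup c s"
  by (simp add: Poly_Mapping.map.rep_eq when_def)

interpretation chain: vector_space "scale :: 'k::field \<Rightarrow> ('v \<Rightarrow>\<^sub>0 'k) \<Rightarrow> ('v \<Rightarrow>\<^sub>0 'k)"
  by unfold_locales
     (auto intro!: poly_mapping_eqI simp: lookup_scale lookup_add algebra_simps)

lemma scale_single: "scale k (Poly_Mapping.single s a) = Poly_Mapping.single s (k * a)"
  by (rule poly_mapping_eqI) (simp add: lookup_scale lookup_single)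

lemma keys_scale: "Poly_Mapping.keys (scale k c) \<subseteq> Poly_Mapping.keys c"
  by (auto simp: in_keys_iff lookup_scale)

lemma chain_expansion:
  fixes c :: "'v \<Rightarrow>\<^sub>0 'k::field"
  shows "c = (\<Sum>s\<in>Poly_Mapping.keys c. scale (Poly_Mapping.lookup c s) (basis_chain s))"
proof (rule poly_mapping_eqI)
  fix t
  have "(\<Sum>s\<in>Poly_Mapping.keys c. Poly_Mapping.lookup c s when s = t)
      = (\<Sum>s\<in>Poly_Mapping.keys c. if s = t then Poly_Mapping.lookup c s else 0)"
    by (rule sum.cong) (auto simp: when_def)
  also have "\<dots> = Poly_Mapping.lookup c t"
    by (auto simp: in_keys_iff)
  finally show "Poly_Mapping.lookup c t
      = Poly_Mapping.lookup (\<Sum>s\<in>Poly_Mapping.keys c. scale (Poly_Mapping.lookup c s) (basis_chain s)) t"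
    by (simp add: lookup_sum lookup_scale lookup_single)
qed

section \<open>Linear maps between chain spaces, determined by their values on simplices\<close>

definition chain_linear :: "(('v \<Rightarrow>\<^sub>0 'k::field) \<Rightarrow> ('w \<Rightarrow>\<^sub>0 'k)) \<Rightarrow> bool" where
  "chain_linear g \<longleftrightarrow> (\<forall>a b. g (a + b) = g a + g b) \<and> (\<forall>k a. g (scale k a) = scale k (g a))"

lemma chain_linearI:
  "\<lbrakk>\<And>a b. g (a + b) = g a + g b; \<And>k a. g (scale k a) = scale k (g a)\<rbrakk> \<Longrightarrow> chain_linear g"
  by (simp add: chain_linear_def)

lemma chain_linear_add: "chain_linear g \<Longrightarrow> g (a + b) = g a + g b"
  by (simp add: chain_linear_def)

lemma chain_linear_scale: "chain_linear g \<Longrightarrow> g (scale k a) = scale k (g a)"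
  by (simp add: chain_linear_def)

lemma chain_linear_0: "chain_linear g \<Longrightarrow> g 0 = 0"
  using chain_linear_add[of g 0 0] by simp

lemma chain_linear_diff: "chain_linear g \<Longrightarrow> g (a - b) = g a - g b"
  using chain_linear_add[of g "a - b" b] by simp

lemma chain_linear_sum: "chain_linear g \<Longrightarrow> g (sum f A) = (\<Sum>x\<in>A. g (f x))"
  by (induction A rule: infinite_finite_induct) (auto simp: chain_linear_0 chain_linear_add)

lemma chain_linear_id: "chain_linear (\<lambda>c. c)"
  by (simp add: chain_linear_def)

lemma chain_linear_plus: "chain_linear g \<Longrightarrow> chain_linear h \<Longrightarrow> chain_linear (\<lambda>c. g c + h c)"
  by (simp add: chain_linear_def chain.scale_right_distrib algebra_simps)

lemma chain_linear_minus: "chain_linear g \<Longrightarrow> chain_linear h \<Longrightarrow> chain_linear (\<lambda>c. g c - h c)"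
  by (simp add: chain_linear_def chain.scale_right_diff_distrib algebra_simps)

lemma chain_linear_comp: "chain_linear g \<Longrightarrow> chain_linear h \<Longrightarrow> chain_linear (\<lambda>c. g (h c))"
  by (simp add: chain_linear_def)

text \<open>Agreement is asked only on the simplices occurring in \<open>c\<close>, so that
  conditions on their length may enter: some identities for \<open>ord_boundary\<close> need
  them.\<close>

lemma chain_linear_eqI:
  assumes "chain_linear g" "chain_linear h"
    and "\<And>s. s \<in> Poly_Mapping.keys c \<Longrightarrow> g (basis_chain s) = h (basis_chain s)"
  shows "g c = h c"
proof -
  have "g (\<Sum>s\<in>Poly_Mapping.keys c. scale (Poly_Mapping.lookup c s) (basis_chain s))
      = h (\<Sum>s\<in>Poly_Mapping.keys c. scale (Poly_Mapping.lookup c s) (basis_chain s))"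
    using assms by (simp add: chain_linear_sum chain_linear_scale del: map_single)
  then show ?thesis by (simp only: chain_expansion[symmetric])
qed

definition lin_ext :: "('v \<Rightarrow> ('w \<Rightarrow>\<^sub>0 'k::field)) \<Rightarrow> ('v \<Rightarrow>\<^sub>0 'k) \<Rightarrow> ('w \<Rightarrow>\<^sub>0 'k)" where
  "lin_ext F c = (\<Sum>s\<in>Poly_Mapping.keys c. scale (Poly_Mapping.lookup c s) (F s))"

lemma lin_ext_superset:
  assumes "finite A" "Poly_Mapping.keys c \<subseteq> A"
  shows "lin_ext F c = (\<Sum>s\<in>A. scale (Poly_Mapping.lookup c s) (F s))"
  unfolding lin_ext_def using assms
  by (intro sum.mono_neutral_left) (auto simp: in_keys_iff)

lemma lin_ext_basis [simp]: "lin_ext F (basis_chain s) = F s"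
  by (simp add: lin_ext_def)

lemma chain_linear_lin_ext:
  fixes F :: "'v \<Rightarrow> ('w \<Rightarrow>\<^sub>0 'k::field)"
  shows "chain_linear (lin_ext F)"
proof (rule chain_linearI)
  fix a b :: "'v \<Rightarrow>\<^sub>0 'k" and k :: 'k
  let ?A = "Poly_Mapping.keys a \<union> Poly_Mapping.keys b"
  have "lin_ext F (a + b) = (\<Sum>s\<in>?A. scale (Poly_Mapping.lookup (a + b) s) (F s))"
    using keys_add[of a b] by (intro lin_ext_superset) auto
  moreover have "lin_ext F a = (\<Sum>s\<in>?A. scale (Poly_Mapping.lookup a s) (F s))"
    by (intro lin_ext_superset) auto
  moreover have "lin_ext F b = (\<Sum>s\<in>?A. scale (Poly_Mapping.lookup b s) (F s))"
    by (intro lin_ext_superset) auto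
  ultimately show "lin_ext F (a + b) = lin_ext F a + lin_ext F b"
    by (simp add: lookup_add chain.scale_left_distrib sum.distrib)
  have "lin_ext F (scale k a) = (\<Sum>s\<in>Poly_Mapping.keys a. scale (Poly_Mapping.lookup (scale k a) s) (F s))"
    using keys_scale[of k a] by (intro lin_ext_superset) auto
  then show "lin_ext F (scale k a) = scale k (lin_ext F a)"
    by (simp add: lookup_scale lin_ext_def chain.scale_sum_right)
qed

lemma keys_lin_ext:
  fixes F :: "'v \<Rightarrow> ('w \<Rightarrow>\<^sub>0 'k::field)"
  shows "Poly_Mapping.keys (lin_ext F c) \<subseteq> (\<Union>s\<in>Poly_Mapping.keys c. Poly_Mapping.keys (F s))"
proof -
  have "Poly_Mapping.keys (lin_ext F c)
      \<subseteq> (\<Union>s\<in>Poly_Mapping.keys c. Poly_Mapping.keys (scale (Poly_Mapping.lookup c s) (F s)))"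
    unfolding lin_ext_def by (rule keys_sum)
  also have "\<dots> \<subseteq> (\<Union>s\<in>Poly_Mapping.keys c. Poly_Mapping.keys (F s))"
    by (intro UN_mono keys_scale order_refl)
  finally show ?thesis .
qed

subsection \<open>Boundary and push-forward\<close>

definition simplex_boundary :: "'v list \<Rightarrow> ('v list \<Rightarrow>\<^sub>0 'k::field)" where
  "simplex_boundary s = (\<Sum>j<length s. Poly_Mapping.single (take j s @ drop (Suc j) s) ((-1) ^ j))"

lemma ord_boundary_lin_ext:
  "ord_boundary = lin_ext (\<lambda>s. if length s \<le> 1 then 0 else simplex_boundary s)"
  by (auto simp: fun_eq_iff ord_boundary_def lin_ext_def simplex_boundary_def chain.scale_sum_right
      scale_single mult.commute intro!: sum.cong)

lemma ord_push_lin_ext: "ord_push p = lin_ext (\<lambda>s. basis_chain (map p s))"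
  by (auto simp: fun_eq_iff ord_push_def lin_ext_def scale_single)

lemma chain_linear_ord_boundary: "chain_linear ord_boundary"
  by (simp add: ord_boundary_lin_ext chain_linear_lin_ext)

lemma chain_linear_ord_push: "chain_linear (ord_push p)"
  by (simp add: ord_push_lin_ext chain_linear_lin_ext)

text \<open>The cone with apex \<open>v\<close>; it turns recursion over \<open>v # s\<close> into
  an operation on chains.\<close>

definition chain_cons :: "'v \<Rightarrow> ('v list \<Rightarrow>\<^sub>0 'k::field) \<Rightarrow> ('v list \<Rightarrow>\<^sub>0 'k)" where
  "chain_cons v = lin_ext (\<lambda>s. basis_chain (v # s))"

text \<open>
  The augmented boundary sends \<open>[v]\<close> to \<open>[]\<close>, so that the recursion over lists has no exceptional
  case in length one. It agrees with \<^const>\<open>ord_boundary\<close> from length two on.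
\<close>

definition aug_boundary :: "('v list \<Rightarrow>\<^sub>0 'k::field) \<Rightarrow> ('v list \<Rightarrow>\<^sub>0 'k)" where
  "aug_boundary = lin_ext simplex_boundary"

lemma chain_linear_chain_cons: "chain_linear (chain_cons v)"
  by (simp add: chain_cons_def chain_linear_lin_ext)

lemma chain_linear_aug_boundary: "chain_linear aug_boundary"
  by (simp add: aug_boundary_def chain_linear_lin_ext)

lemma simplex_boundary_Cons:
  "simplex_boundary (v # s) = basis_chain s - chain_cons v (simplex_boundary s)"
proof -
  have cons_single: "chain_cons v (Poly_Mapping.single t a) = Poly_Mapping.single (v # t) a"
    for t and a :: 'b
    using chain_linear_scale[OF chain_linear_chain_cons, of v a "basis_chain t"]
    by (simp add: scale_single chain_cons_def)
  show ?thesis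
    by (simp add: simplex_boundary_def sum.lessThan_Suc_shift del: sum.lessThan_Suc)
       (simp add: chain_linear_sum[OF chain_linear_chain_cons] cons_single single_uminus sum_negf)
qed

text \<open>The cone formula: deleting the apex gives back \<open>c\<close>, deleting a later vertex
  leaves a cone with the opposite sign. The augmentation makes it hold in every degree.\<close>

lemma aug_boundary_chain_cons: "aug_boundary (chain_cons v c) = c - chain_cons v (aug_boundary c)"
proof (rule chain_linear_eqI[where c = c])
  show "chain_linear (\<lambda>c. aug_boundary (chain_cons v c))"
    by (intro chain_linear_comp[OF chain_linear_aug_boundary] chain_linear_chain_cons)
  show "chain_linear (\<lambda>c. c - chain_cons v (aug_boundary c))"
    by (intro chain_linear_minus chain_linear_id chain_linear_comp[OF chain_linear_chain_cons]
        chain_linear_aug_boundary)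
qed (simp add: chain_cons_def aug_boundary_def simplex_boundary_Cons)

lemma ord_push_chain_cons: "ord_push p (chain_cons v c) = chain_cons (p v) (ord_push p c)"
proof (rule chain_linear_eqI[where c = c])
  show "chain_linear (\<lambda>c. ord_push p (chain_cons v c))"
    by (intro chain_linear_comp[OF chain_linear_ord_push] chain_linear_chain_cons)
  show "chain_linear (\<lambda>c. chain_cons (p v) (ord_push p c))"
    by (intro chain_linear_comp[OF chain_linear_chain_cons] chain_linear_ord_push)
qed (simp add: ord_push_lin_ext chain_cons_def)

section \<open>Naturality of the boundary and the prism homotopy, by induction on lists\<close>

lemma basis_chain_Cons: "basis_chain (v # s) = chain_cons v (basis_chain s)"
  by (simp add: chain_cons_def)

lemma aug_boundary_ord_push:
  fixes c :: "'v list \<Rightarrow>\<^sub>0 'k::field"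
  shows "aug_boundary (ord_push p c) = ord_push p (aug_boundary c)"
proof (rule chain_linear_eqI[where c = c])
  fix s :: "'v list"
  show "aug_boundary (ord_push p (basis_chain s :: _ \<Rightarrow>\<^sub>0 'k)) = ord_push p (aug_boundary (basis_chain s))"
  proof (induction s)
    case Nil
    then show ?case
      by (simp add: aug_boundary_def ord_push_lin_ext simplex_boundary_def
          chain_linear_0[OF chain_linear_lin_ext])
  next
    case (Cons v s)
    then show ?case
      by (simp add: basis_chain_Cons ord_push_chain_cons aug_boundary_chain_cons
          chain_linear_diff[OF chain_linear_ord_push])
  qed
qed (intro chain_linear_comp[OF chain_linear_aug_boundary] chain_linear_comp[OF chain_linear_ord_push]
    chain_linear_aug_boundary chain_linear_ord_push)+

text \<open>Unfolded, \<open>[v_0, ..., v_n]\<close> goes to the alternating sum over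
  \<open>j\<close> of \<open>[p v_0, ..., p v_j, p' v_j, ..., p' v_n]\<close>; recursion on the
  first vertex fits the cone formula.\<close>

fun prism :: "('v \<Rightarrow> 'w) \<Rightarrow> ('v \<Rightarrow> 'w) \<Rightarrow> 'v list \<Rightarrow> ('w list \<Rightarrow>\<^sub>0 'k::field)" where
  "prism p p' [] = 0"
| "prism p p' (v # s) = basis_chain (p v # p' v # map p' s) - chain_cons (p v) (prism p p' s)"

lemma lin_ext_prism_chain_cons:
  "lin_ext (prism p p') (chain_cons v c)
     = chain_cons (p v) (chain_cons (p' v) (ord_push p' c)) - chain_cons (p v) (lin_ext (prism p p') c)"
proof (rule chain_linear_eqI[where c = c])
  show "chain_linear (\<lambda>c. lin_ext (prism p p') (chain_cons v c))"
    by (intro chain_linear_comp[OF chain_linear_lin_ext] chain_linear_chain_cons)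
  show "chain_linear (\<lambda>c. chain_cons (p v) (chain_cons (p' v) (ord_push p' c))
      - chain_cons (p v) (lin_ext (prism p p') c))"
    by (intro chain_linear_minus chain_linear_comp[OF chain_linear_chain_cons]
        chain_linear_ord_push chain_linear_lin_ext)
qed (simp add: chain_cons_def ord_push_lin_ext)

text \<open>The prism operator is a chain homotopy between the two push-forwards. By linearity a
  single simplex suffices, and induction strips off its first vertex.\<close>

lemma aug_boundary_prism:
  fixes c :: "'v list \<Rightarrow>\<^sub>0 'k::field"
  shows "aug_boundary (lin_ext (prism p p') c) + lin_ext (prism p p') (aug_boundary c)
     = ord_push p' c - ord_push p c"
proof (rule chain_linear_eqI[where c = c])
  fix s :: "'v list"
  show "aug_boundary (lin_ext (prism p p') (basis_chain s :: _ \<Rightarrow>\<^sub>0 'k))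
        + lin_ext (prism p p') (aug_boundary (basis_chain s))
      = ord_push p' (basis_chain s) - ord_push p (basis_chain s)"
  proof (induction s)
    case Nil
    then show ?case
      by (simp add: aug_boundary_def ord_push_lin_ext simplex_boundary_def
          chain_linear_0[OF chain_linear_lin_ext])
  next
    case (Cons v s)
    let ?D = "lin_ext (prism p p')" and ?c = "basis_chain s :: _ \<Rightarrow>\<^sub>0 'k"
    note diff = chain_linear_diff[OF chain_linear_aug_boundary] chain_linear_diff[OF chain_linear_lin_ext]
      chain_linear_diff[OF chain_linear_chain_cons]
    \<comment> \<open>Under the cone formula the terms with both \<open>p v\<close> and
      \<open>p' v\<close> and the bare terms \<open>?D ?c\<close> cancel. Besides two cones over
      \<open>ord_push p' ?c\<close> there remains the cone with apex \<open>p v\<close> over the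
      left side for the tail, ready for the induction hypothesis.\<close>
    have "aug_boundary (?D (chain_cons v ?c)) + ?D (aug_boundary (chain_cons v ?c))
        = chain_cons (p' v) (ord_push p' ?c) - chain_cons (p v) (ord_push p' ?c)
          + chain_cons (p v) (aug_boundary (?D ?c) + ?D (aug_boundary ?c))"
      by (simp add: lin_ext_prism_chain_cons aug_boundary_chain_cons diff aug_boundary_ord_push
          chain_linear_add[OF chain_linear_chain_cons] del: lin_ext_basis)
    also have "\<dots> = chain_cons (p' v) (ord_push p' ?c) - chain_cons (p v) (ord_push p ?c)"
      by (simp only: Cons.IH diff) simp
    finally show ?case
      by (simp add: basis_chain_Cons ord_push_chain_cons del: lin_ext_basis)
  qed
qed (intro chain_linear_comp[OF chain_linear_aug_boundary] chain_linear_comp[OF chain_linear_lin_ext]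
    chain_linear_plus chain_linear_minus chain_linear_aug_boundary chain_linear_lin_ext chain_linear_ord_push)+

section \<open>Simplices of prism chains, and return to the unaugmented boundary\<close>

lemma keys_chain_cons: "Poly_Mapping.keys (chain_cons v c) \<subseteq> (#) v ` Poly_Mapping.keys c"
  using keys_lin_ext[of "\<lambda>s. basis_chain (v # s)" c] by (auto simp: chain_cons_def)

lemma keys_prism:
  assumes "t \<in> Poly_Mapping.keys (prism p p' s :: 'w list \<Rightarrow>\<^sub>0 'k::field)"
  shows "length t = Suc (length s) \<and> set t \<subseteq> p ` set s \<union> p' ` set s"
  using assms
proof (induction s arbitrary: t)
  case (Cons v s)
  have "t = p v # p' v # map p' s \<or> t \<in> (#) (p v) ` Poly_Mapping.keys (prism p p' s :: 'w list \<Rightarrow>\<^sub>0 'k)"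
    using Cons.prems keys_diff[of "basis_chain (p v # p' v # map p' s) :: 'w list \<Rightarrow>\<^sub>0 'k"
        "chain_cons (p v) (prism p p' s)"] keys_chain_cons[of "p v" "prism p p' s :: 'w list \<Rightarrow>\<^sub>0 'k"]
    by auto
  then show ?case
  proof (elim disjE imageE)
    fix t' assume t': "t = p v # t'" "t' \<in> Poly_Mapping.keys (prism p p' s :: 'w list \<Rightarrow>\<^sub>0 'k)"
    show ?thesis using Cons.IH[OF t'(2)] t'(1) by auto
  qed auto
qed simp

lemma ord_boundary_eq_aug_boundary:
  assumes "\<And>s. s \<in> Poly_Mapping.keys c \<Longrightarrow> 2 \<le> length s"
  shows "ord_boundary c = aug_boundary c"
proof (rule chain_linear_eqI[where c = c])
  fix s assume "s \<in> Poly_Mapping.keys c"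
  then show "ord_boundary (basis_chain s) = aug_boundary (basis_chain s)"
    using assms[of s] by (simp add: ord_boundary_lin_ext aug_boundary_def)
qed (rule chain_linear_ord_boundary chain_linear_aug_boundary)+

lemma ord_boundary_ord_push: "ord_boundary (ord_push p c) = ord_push p (ord_boundary c)"
proof (rule chain_linear_eqI[where c = c])
  fix s
  show "ord_boundary (ord_push p (basis_chain s)) = ord_push p (ord_boundary (basis_chain s))"
    using aug_boundary_ord_push[of p "basis_chain s"]
    by (auto simp: ord_boundary_lin_ext aug_boundary_def ord_push_lin_ext
        chain_linear_0[OF chain_linear_lin_ext])
qed (intro chain_linear_comp[OF chain_linear_ord_boundary] chain_linear_comp[OF chain_linear_ord_push]
    chain_linear_ord_push chain_linear_ord_boundary)+

lemma ord_push_compose: "ord_push p' (ord_push p c) = ord_push (\<lambda>x. p' (p x)) c"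
proof (rule chain_linear_eqI[where c = c])
  fix s
  show "ord_push p' (ord_push p (basis_chain s)) = ord_push (\<lambda>x. p' (p x)) (basis_chain s)"
    by (simp add: ord_push_lin_ext comp_def)
qed (intro chain_linear_comp[OF chain_linear_ord_push] chain_linear_ord_push)+

text \<open>On nonempty simplices the augmentation is invisible: prism chains have length at least
  two, and the empty list, which is all that \<open>aug_boundary\<close> adds on a single vertex,
  has prism \<open>0\<close>.\<close>

lemma ord_boundary_prism:
  fixes c :: "'v list \<Rightarrow>\<^sub>0 'k::field"
  assumes "[] \<notin> Poly_Mapping.keys c"
  shows "ord_boundary (lin_ext (prism p p') c) + lin_ext (prism p p') (ord_boundary c)
     = ord_push p' c - ord_push p c"
proof (rule chain_linear_eqI[where c = c])
  fix s assume "s \<in> Poly_Mapping.keys c"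
  then obtain v t where s: "s = v # t"
    using assms by (cases s) auto
  let ?D = "lin_ext (prism p p') :: _ \<Rightarrow> (_ \<Rightarrow>\<^sub>0 'k)" and ?b = "basis_chain s :: _ \<Rightarrow>\<^sub>0 'k"
  have "ord_boundary (?D ?b) = aug_boundary (?D ?b)"
    using keys_prism[of _ p p' s, where 'k = 'k] s by (intro ord_boundary_eq_aug_boundary) auto
  moreover have "?D (ord_boundary ?b) = ?D (aug_boundary ?b)"
    by (auto simp: s ord_boundary_lin_ext aug_boundary_def simplex_boundary_def
        chain_linear_0[OF chain_linear_lin_ext])
  ultimately show "ord_boundary (?D ?b) + ?D (ord_boundary ?b) = ord_push p' ?b - ord_push p ?b"
    by (simp only: aug_boundary_prism)
qed (intro chain_linear_comp[OF chain_linear_ord_boundary] chain_linear_comp[OF chain_linear_lin_ext]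
    chain_linear_plus chain_linear_minus chain_linear_ord_boundary chain_linear_lin_ext
    chain_linear_ord_push)+

section \<open>Simplicial homology\<close>

text \<open>The diagonal case \<open>p' = p\<close> serves as the notion of simplicial map.
  Quantifying over every nonempty \<open>\<rho>\<close> builds in the passage to faces.\<close>

definition contiguous :: "'v set set \<Rightarrow> 'w set set \<Rightarrow> ('v \<Rightarrow> 'w) \<Rightarrow> ('v \<Rightarrow> 'w) \<Rightarrow> bool" where
  "contiguous K L p p' \<longleftrightarrow> (\<forall>\<sigma>\<in>K. \<forall>\<rho>. \<rho> \<noteq> {} \<and> \<rho> \<subseteq> p ` \<sigma> \<union> p' ` \<sigma> \<longrightarrow> \<rho> \<in> L)"

lemma subspace_ord_chains: "chain.subspace (ord_chains q K :: ('v list \<Rightarrow>\<^sub>0 'k::field) set)"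
  unfolding chain.subspace_def
proof (intro conjI allI ballI)
  fix a b :: "'v list \<Rightarrow>\<^sub>0 'k" and k :: 'k
  assume a: "a \<in> ord_chains q K"
  show "scale k a \<in> ord_chains q K"
    using a keys_scale[of k a] by (auto simp: ord_chains_def)
  assume b: "b \<in> ord_chains q K"
  show "a + b \<in> ord_chains q K"
    using a b keys_add[of a b] unfolding ord_chains_def by blast
qed (simp add: ord_chains_def)

lemma subspace_ord_boundaries: "chain.subspace (ord_boundaries q K :: ('v list \<Rightarrow>\<^sub>0 'k::field) set)"
  unfolding chain.subspace_def ord_boundaries_def
proof (intro conjI allI ballI)
  show "0 \<in> ord_boundary ` ord_chains (q + 1) K"
    using chain.subspace_0[OF subspace_ord_chains]
    by (rule rev_image_eqI) (simp add: chain_linear_0[OF chain_linear_ord_boundary])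
next
  fix a b :: "'v list \<Rightarrow>\<^sub>0 'k"
  assume "a \<in> ord_boundary ` ord_chains (q + 1) K" "b \<in> ord_boundary ` ord_chains (q + 1) K"
  then show "a + b \<in> ord_boundary ` ord_chains (q + 1) K"
    using chain_linear_add[OF chain_linear_ord_boundary, symmetric]
    by (auto intro!: imageI chain.subspace_add[OF subspace_ord_chains])
next
  fix k and a :: "'v list \<Rightarrow>\<^sub>0 'k"
  assume "a \<in> ord_boundary ` ord_chains (q + 1) K"
  then show "scale k a \<in> ord_boundary ` ord_chains (q + 1) K"
    using chain_linear_scale[OF chain_linear_ord_boundary, symmetric]
    by (auto intro!: imageI chain.subspace_scale[OF subspace_ord_chains])
qed

lemma subspace_ord_cycles: "chain.subspace (ord_cycles q K)"
  using chain.subspace_0[OF subspace_ord_chains] chain.subspace_add[OF subspace_ord_chains]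
    chain.subspace_scale[OF subspace_ord_chains]
  by (auto simp: chain.subspace_def ord_cycles_def chain_linear_0[OF chain_linear_ord_boundary]
      chain_linear_add[OF chain_linear_ord_boundary] chain_linear_scale[OF chain_linear_ord_boundary])

lemma ord_push_chains:
  assumes "contiguous K L p p" "c \<in> ord_chains q K"
  shows "ord_push p c \<in> ord_chains q L"
proof -
  have "set (map p s) \<in> L" if "set s \<in> K" "s \<noteq> []" for s
    using assms(1) that by (auto simp: contiguous_def)
  moreover have "Poly_Mapping.keys (ord_push p c) \<subseteq> map p ` Poly_Mapping.keys c"
    using keys_lin_ext[of "\<lambda>s. basis_chain (map p s)" c] by (auto simp: ord_push_lin_ext)
  ultimately show ?thesis
    using assms(2) unfolding ord_chains_def by auto
qed

lemma ord_push_cycles: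
  "contiguous K L p p \<Longrightarrow> z \<in> ord_cycles q K \<Longrightarrow> ord_push p z \<in> ord_cycles q L"
  by (simp add: ord_cycles_def ord_push_chains ord_boundary_ord_push
      chain_linear_0[OF chain_linear_ord_push])

lemma ord_push_boundaries:
  "contiguous K L p p \<Longrightarrow> b \<in> ord_boundaries q K \<Longrightarrow> ord_push p b \<in> ord_boundaries q L"
  by (auto simp: ord_boundaries_def ord_push_chains simp flip: ord_boundary_ord_push)

text \<open>As \<open>z\<close> is a cycle, the homotopy formula loses one term and exhibits the
  difference as the boundary of the prism over \<open>z\<close>; contiguity keeps that prism inside
  \<open>L\<close>.\<close>

lemma contiguous_ord_push_diff:
  fixes z :: "'v list \<Rightarrow>\<^sub>0 'k::field" and p p' :: "'v \<Rightarrow> 'w"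
  assumes "contiguous K L p p'" "z \<in> ord_cycles q K"
  shows "ord_push p' z - ord_push p z \<in> ord_boundaries q L"
proof -
  let ?D = "lin_ext (prism p p') z"
  have z: "\<And>s. s \<in> Poly_Mapping.keys z \<Longrightarrow> s \<noteq> [] \<and> set s \<in> K \<and> int (length s) = q + 1"
    "ord_boundary z = 0"
    using assms(2) by (auto simp: ord_cycles_def ord_chains_def)
  have "?D \<in> ord_chains (q + 1) L"
    unfolding ord_chains_def
  proof (intro CollectI ballI)
    fix t assume "t \<in> Poly_Mapping.keys ?D"
    then obtain s where s: "s \<in> Poly_Mapping.keys z" "t \<in> Poly_Mapping.keys (prism p p' s :: 'w list \<Rightarrow>\<^sub>0 'k)"
      using keys_lin_ext[of "prism p p'" z] by blast
    note t = keys_prism[OF s(2)]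
    have "t \<noteq> []" using t by auto
    moreover have "set t \<in> L"
      using assms(1) z(1)[OF s(1)] t \<open>t \<noteq> []\<close> by (auto simp: contiguous_def)
    ultimately show "t \<noteq> [] \<and> set t \<in> L \<and> int (length t) = q + 1 + 1"
      using z(1)[OF s(1)] t by simp
  qed
  moreover have "ord_boundary ?D = ord_push p' z - ord_push p z"
    using ord_boundary_prism[of z p p'] z by (auto simp: chain_linear_0[OF chain_linear_lin_ext])
  ultimately show ?thesis
    unfolding ord_boundaries_def by (intro rev_image_eqI[of ?D]) auto
qed

section \<open>Homology as cosets, with its operations and induced maps\<close>

definition homology_class :: "int \<Rightarrow> 'v set set \<Rightarrow> ('v list \<Rightarrow>\<^sub>0 'k::field) \<Rightarrow> ('v list \<Rightarrow>\<^sub>0 'k) set" where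
  "homology_class q K z = (\<lambda>b. z + b) ` ord_boundaries q K"

lemma mem_homology_class: "a \<in> homology_class q K z \<longleftrightarrow> a - z \<in> ord_boundaries q K"
proof
  assume "a - z \<in> ord_boundaries q K"
  then show "a \<in> homology_class q K z"
    unfolding homology_class_def by (rule rev_image_eqI) simp
qed (auto simp: homology_class_def)

lemma homology_class_eqI:
  assumes "a - b \<in> ord_boundaries q K"
  shows "homology_class q K a = homology_class q K b"
proof -
  have "x - a \<in> ord_boundaries q K \<longleftrightarrow> x - b \<in> ord_boundaries q K" for x
    using chain.subspace_add[OF subspace_ord_boundaries _ assms, of "x - a"]
      chain.subspace_diff[OF subspace_ord_boundaries _ assms, of "x - b"] by auto
  then show ?thesis by (auto simp: mem_homology_class)
qed

lemma carrier_simp_homology: "carrier (simp_homology q K) = homology_class q K ` ord_cycles q K"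
  by (simp add: simp_homology_def homology_class_def)

lemma zero_simp_homology: "\<zero>\<^bsub>simp_homology q K\<^esub> = homology_class q K 0"
  by (simp add: simp_homology_def homology_class_def)

lemma add_simp_homology:
  "homology_class q K a \<oplus>\<^bsub>simp_homology q K\<^esub> homology_class q K b = homology_class q K (a + b)"
proof (intro equalityI subsetI)
  fix x assume "x \<in> homology_class q K a \<oplus>\<^bsub>simp_homology q K\<^esub> homology_class q K b"
  then obtain y z where x: "x = y + z" "y - a \<in> ord_boundaries q K" "z - b \<in> ord_boundaries q K"
    by (auto simp: simp_homology_def mem_homology_class)
  have "x - (a + b) = (y - a) + (z - b)" by (simp add: x(1))
  then show "x \<in> homology_class q K (a + b)"
    using chain.subspace_add[OF subspace_ord_boundaries x(2,3)] by (simp only: mem_homology_class)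
next
  fix x assume "x \<in> homology_class q K (a + b)"
  then have "x - b \<in> homology_class q K a"
    by (simp add: mem_homology_class diff_diff_eq add.commute)
  moreover have "b \<in> homology_class q K b"
    by (simp add: mem_homology_class chain.subspace_0[OF subspace_ord_boundaries])
  ultimately have "\<exists>y z. x = y + z \<and> y \<in> homology_class q K a \<and> z \<in> homology_class q K b"
    by (intro exI[of _ "x - b"] exI[of _ b]) simp
  then show "x \<in> homology_class q K a \<oplus>\<^bsub>simp_homology q K\<^esub> homology_class q K b"
    by (simp add: simp_homology_def)
qed

lemma smult_simp_homology:
  "k \<odot>\<^bsub>simp_homology q K\<^esub> homology_class q K a = homology_class q K (scale k a)"
proof (intro equalityI subsetI)
  fix x assume "x \<in> k \<odot>\<^bsub>simp_homology q K\<^esub> homology_class q K a"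
  then obtain y z where x: "x = scale k y + z" "y - a \<in> ord_boundaries q K" "z \<in> ord_boundaries q K"
    by (auto simp: simp_homology_def mem_homology_class)
  have "x - scale k a = scale k (y - a) + z"
    using x(1) by (simp add: chain.scale_right_diff_distrib)
  then show "x \<in> homology_class q K (scale k a)"
    using chain.subspace_add[OF subspace_ord_boundaries
        chain.subspace_scale[OF subspace_ord_boundaries x(2)] x(3)] by (simp add: mem_homology_class)
next
  fix x assume "x \<in> homology_class q K (scale k a)"
  then have "x - scale k a \<in> ord_boundaries q K"
    by (simp add: mem_homology_class)
  moreover have "a \<in> homology_class q K a"
    by (simp add: mem_homology_class chain.subspace_0[OF subspace_ord_boundaries])
  ultimately have "\<exists>y z. x = scale k y + z \<and> y \<in> homology_class q K a \<and> z \<in> ord_boundaries q K"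
    by (intro exI[of _ a] exI[of _ "x - scale k a"]) simp
  then show "x \<in> k \<odot>\<^bsub>simp_homology q K\<^esub> homology_class q K a"
    by (simp add: simp_homology_def)
qed

text \<open>The push-forward of a coset may be smaller than a coset; adding the boundaries of
  \<open>L\<close> fills it up.\<close>

lemma simp_homology_map_class:
  assumes "contiguous K L p p"
  shows "simp_homology_map q L p (homology_class q K z) = homology_class q L (ord_push p z)"
proof (intro equalityI subsetI)
  fix x assume "x \<in> simp_homology_map q L p (homology_class q K z)"
  then obtain a b where x: "x = ord_push p a + b" "a - z \<in> ord_boundaries q K" "b \<in> ord_boundaries q L"
    by (auto simp: simp_homology_map_def mem_homology_class)
  have "x - ord_push p z = ord_push p (a - z) + b"
    using x(1) by (simp add: chain_linear_diff[OF chain_linear_ord_push])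
  then show "x \<in> homology_class q L (ord_push p z)"
    using chain.subspace_add[OF subspace_ord_boundaries
        ord_push_boundaries[OF assms x(2)] x(3)] by (simp add: mem_homology_class)
next
  fix x assume "x \<in> homology_class q L (ord_push p z)"
  then have "x - ord_push p z \<in> ord_boundaries q L"
    by (simp add: mem_homology_class)
  moreover have "z \<in> homology_class q K z"
    by (simp add: mem_homology_class chain.subspace_0[OF subspace_ord_boundaries])
  moreover have "x = ord_push p z + (x - ord_push p z)" by simp
  ultimately show "x \<in> simp_homology_map q L p (homology_class q K z)"
    unfolding simp_homology_map_def by blast
qed

section \<open>Linear maps\<close>

definition lin_space :: "('k::field, 'm) module \<Rightarrow> bool" where
  "lin_space M \<longleftrightarrow> abelian_monoid M \<and> (\<forall>k. \<forall>x\<in>carrier M. k \<odot>\<^bsub>M\<^esub> x \<in> carrier M)"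

definition lin_map :: "('k::field, 'm) module \<Rightarrow> ('k, 'n) module \<Rightarrow> ('m \<Rightarrow> 'n) \<Rightarrow> bool" where
  "lin_map M N g \<longleftrightarrow> g \<in> carrier M \<rightarrow> carrier N \<and> g \<zero>\<^bsub>M\<^esub> = \<zero>\<^bsub>N\<^esub> \<and>
     (\<forall>x\<in>carrier M. \<forall>y\<in>carrier M. g (x \<oplus>\<^bsub>M\<^esub> y) = g x \<oplus>\<^bsub>N\<^esub> g y) \<and>
     (\<forall>k. \<forall>x\<in>carrier M. g (k \<odot>\<^bsub>M\<^esub> x) = k \<odot>\<^bsub>N\<^esub> g x)"

lemma lin_mapD:
  assumes "lin_map M N g"
  shows lin_map_closed: "x \<in> carrier M \<Longrightarrow> g x \<in> carrier N"
    and lin_map_zero: "g \<zero>\<^bsub>M\<^esub> = \<zero>\<^bsub>N\<^esub>"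
    and lin_map_add: "\<lbrakk>x \<in> carrier M; y \<in> carrier M\<rbrakk> \<Longrightarrow> g (x \<oplus>\<^bsub>M\<^esub> y) = g x \<oplus>\<^bsub>N\<^esub> g y"
    and lin_map_smult: "x \<in> carrier M \<Longrightarrow> g (k \<odot>\<^bsub>M\<^esub> x) = k \<odot>\<^bsub>N\<^esub> g x"
  using assms by (auto simp: lin_map_def)

lemma lin_map_finsum:
  assumes "lin_space M" "lin_space N" "lin_map M N g" "finite A" "h \<in> A \<rightarrow> carrier M"
  shows "g (\<Oplus>\<^bsub>M\<^esub>x\<in>A. h x) = (\<Oplus>\<^bsub>N\<^esub>x\<in>A. g (h x))"
proof -
  interpret M: abelian_monoid M using assms(1) by (simp add: lin_space_def)
  interpret N: abelian_monoid N using assms(2) by (simp add: lin_space_def)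
  show ?thesis
    using assms(4,5)
  proof (induction A rule: finite_induct)
    case empty
    then show ?case by (simp add: lin_map_zero[OF assms(3)])
  next
    case (insert a A)
    have "h a \<in> carrier M" "h \<in> A \<rightarrow> carrier M" using insert.prems by auto
    moreover have "(\<lambda>x. g (h x)) \<in> A \<rightarrow> carrier N" "g (h a) \<in> carrier N"
      using insert.prems lin_map_closed[OF assms(3)] by auto
    ultimately show ?case
      using insert by (simp add: M.finsum_insert N.finsum_insert lin_map_add[OF assms(3)] M.finsum_closed)
  qed
qed

text \<open>Independent vectors of \<open>V\<close> have preimages in \<open>W\<close>, and
  \<open>g\<close> carries a relation among the preimages to the same relation among the vectors. So
  each finite independent family lifts to one of equal size.\<close>

lemma subspace_dim_factor:
  assumes "lin_space M" "lin_space N" "lin_map M N g" "W \<subseteq> carrier M" "V \<subseteq> g ` W"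
  shows "subspace_dim N V \<le> subspace_dim M W"
  unfolding subspace_dim_def
proof (rule SUP_mono)
  fix S assume "S \<in> {S. S \<subseteq> V \<and> lin_indep_in N S}"
  then have S: "S \<subseteq> V" "finite S"
    and indep: "\<And>a. (\<Oplus>\<^bsub>N\<^esub>x\<in>S. a x \<odot>\<^bsub>N\<^esub> x) = \<zero>\<^bsub>N\<^esub> \<Longrightarrow> \<forall>x\<in>S. a x = 0"
    by (auto simp: lin_indep_in_def)
  interpret M: abelian_monoid M using assms(1) by (simp add: lin_space_def)
  interpret N: abelian_monoid N using assms(2) by (simp add: lin_space_def)
  have "\<forall>x\<in>S. \<exists>y. y \<in> W \<and> g y = x"
    using S(1) assms(5) by auto
  then obtain r where r: "\<And>x. x \<in> S \<Longrightarrow> r x \<in> W \<and> g (r x) = x"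
    by (auto dest!: bchoice)
  have inj: "inj_on r S"
    by (metis inj_onI r)
  have S_N: "x \<in> carrier N" if "x \<in> S" for x
    using r[OF that] assms(4) lin_map_closed[OF assms(3)] by (metis subsetD)
  have "lin_indep_in M (r ` S)"
    unfolding lin_indep_in_def
  proof (intro conjI allI impI)
    show "r ` S \<subseteq> carrier M" using r assms(4) by auto
    show "finite (r ` S)" using S(2) by simp
    fix a assume a: "(\<Oplus>\<^bsub>M\<^esub>x\<in>r ` S. a x \<odot>\<^bsub>M\<^esub> x) = \<zero>\<^bsub>M\<^esub>"
    have smult_M: "(\<lambda>x. a x \<odot>\<^bsub>M\<^esub> x) \<in> r ` S \<rightarrow> carrier M"
      using assms(1,4) r by (auto simp: lin_space_def)
    have "\<zero>\<^bsub>N\<^esub> = g (\<Oplus>\<^bsub>M\<^esub>x\<in>r ` S. a x \<odot>\<^bsub>M\<^esub> x)"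
      by (simp add: a lin_map_zero[OF assms(3)])
    also have "\<dots> = g (\<Oplus>\<^bsub>M\<^esub>x\<in>S. a (r x) \<odot>\<^bsub>M\<^esub> r x)"
      using M.add.finprod_reindex[OF smult_M inj] by simp
    also have "\<dots> = (\<Oplus>\<^bsub>N\<^esub>x\<in>S. g (a (r x) \<odot>\<^bsub>M\<^esub> r x))"
      using smult_M by (intro lin_map_finsum[OF assms(1,2,3) S(2)]) auto
    also have "\<dots> = (\<Oplus>\<^bsub>N\<^esub>x\<in>S. a (r x) \<odot>\<^bsub>N\<^esub> x)"
    proof (rule N.finsum_cong')
      show "(\<lambda>x. a (r x) \<odot>\<^bsub>N\<^esub> x) \<in> S \<rightarrow> carrier N"
        using assms(2) S_N by (auto simp: lin_space_def)
      show "g (a (r x) \<odot>\<^bsub>M\<^esub> r x) = a (r x) \<odot>\<^bsub>N\<^esub> x" if "x \<in> S" for x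
        using r[OF that] assms(4) lin_map_smult[OF assms(3), of "r x" "a (r x)"] by auto
    qed simp
    finally have "\<forall>x\<in>S. a (r x) = 0"
      by (intro indep) simp
    then show "\<forall>x\<in>r ` S. a x = 0" by auto
  qed
  then show "\<exists>T\<in>{T. T \<subseteq> W \<and> lin_indep_in M T}. enat (card S) \<le> enat (card T)"
    using r card_image[OF inj] by (intro bexI[of _ "r ` S"]) auto
qed

lemma lin_space_simp_homology: "lin_space (simp_homology q K :: ('k::field, _) module)"
  unfolding lin_space_def
proof (intro conjI allI ballI)
  note closed = chain.subspace_0[OF subspace_ord_cycles] chain.subspace_add[OF subspace_ord_cycles]
    chain.subspace_scale[OF subspace_ord_cycles]
  show "abelian_monoid (simp_homology q K :: ('k::field, _) module)"
    using closed
    by (intro abelian_monoidI)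
       (auto simp: carrier_simp_homology zero_simp_homology add_simp_homology ac_simps
         intro!: imageI)
  fix k :: 'k and x assume "x \<in> carrier (simp_homology q K :: ('k, _) module)"
  then show "k \<odot>\<^bsub>simp_homology q K\<^esub> x \<in> carrier (simp_homology q K)"
    using closed by (auto simp: carrier_simp_homology smult_simp_homology intro!: imageI)
qed

section \<open>Nerves\<close>

text \<open>The choice hidden in \<open>nerve_homology_map\<close>, made explicit so that two
  different maps can share one \<open>p\<close>.\<close>

definition carries :: "('a \<Rightarrow> 'b) \<Rightarrow> 'a set set \<Rightarrow> 'b set set \<Rightarrow> ('a set \<Rightarrow> 'b set) \<Rightarrow> bool" where
  "carries g \<U> \<V> p \<longleftrightarrow> (\<forall>U\<in>\<U>. p U \<in> \<V> \<and> g ` U \<subseteq> p U)"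

lemma carries_compose:
  assumes "carries g \<U> \<V> p" "carries h \<V> \<W> p'"
  shows "carries (\<lambda>x. h (g x)) \<U> \<W> (\<lambda>U. p' (p U))"
  unfolding carries_def
proof (intro ballI conjI)
  fix U assume "U \<in> \<U>"
  then have "p U \<in> \<V>" "g ` U \<subseteq> p U" using assms(1) by (auto simp: carries_def)
  moreover from this have "p' (p U) \<in> \<W>" "h ` p U \<subseteq> p' (p U)" using assms(2) by (auto simp: carries_def)
  ultimately show "p' (p U) \<in> \<W>" "(\<lambda>x. h (g x)) ` U \<subseteq> p' (p U)" by auto
qed

text \<open>A point common to all members of \<open>\<sigma>\<close> is sent by \<open>g\<close>
  into all their images under \<open>p\<close> and \<open>p'\<close>, so these images have a common
  point.\<close>

lemma carries_contiguous:
  assumes "carries g \<U> \<V> p" "carries g \<U> \<V> p'"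
  shows "contiguous (nerve \<U>) (nerve \<V>) p p'"
  unfolding contiguous_def
proof (intro ballI allI impI)
  fix \<sigma> \<rho> assume \<sigma>: "\<sigma> \<in> nerve \<U>" and \<rho>: "\<rho> \<noteq> {} \<and> \<rho> \<subseteq> p ` \<sigma> \<union> p' ` \<sigma>"
  obtain x where x: "\<And>U. U \<in> \<sigma> \<Longrightarrow> x \<in> U" and \<sigma>': "finite \<sigma>" "\<sigma> \<subseteq> \<U>"
    using \<sigma> by (auto simp: nerve_def)
  have "finite \<rho>"
    using \<rho> \<sigma>'(1) by (meson finite_UnI finite_imageI finite_subset)
  moreover have "\<forall>V\<in>\<rho>. V \<in> \<V> \<and> g x \<in> V"
    using \<rho> \<sigma>'(2) x assms unfolding carries_def by blast
  ultimately show "\<rho> \<in> nerve \<V>"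
    using \<rho> by (auto simp: nerve_def)
qed

text \<open>By contiguity any carrying \<open>p\<close> computes the same map as the one taken by
  \<open>SOME\<close>.\<close>

lemma nerve_homology_map_class:
  assumes "carries g \<U> \<V> p" "z \<in> ord_cycles q (nerve \<U>)"
  shows "nerve_homology_map q g \<U> \<V> (homology_class q (nerve \<U>) z) = homology_class q (nerve \<V>) (ord_push p z)"
proof -
  let ?p = "SOME p. \<forall>U\<in>\<U>. p U \<in> \<V> \<and> g ` U \<subseteq> p U"
  have p: "carries g \<U> \<V> ?p"
    using assms(1) unfolding carries_def
    by (rule someI[where P = "\<lambda>p. \<forall>U\<in>\<U>. p U \<in> \<V> \<and> g ` U \<subseteq> p U"])
  have "nerve_homology_map q g \<U> \<V> (homology_class q (nerve \<U>) z) = homology_class q (nerve \<V>) (ord_push ?p z)"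
    unfolding nerve_homology_map_def
    by (rule simp_homology_map_class) (rule carries_contiguous[OF p p])
  also have "\<dots> = homology_class q (nerve \<V>) (ord_push p z)"
    by (intro homology_class_eqI contiguous_ord_push_diff[OF carries_contiguous[OF assms(1) p] assms(2)])
  finally show ?thesis .
qed

lemma lin_map_nerve_homology_map:
  assumes "carries g \<U> \<V> p"
  shows "lin_map (simp_homology q (nerve \<U>)) (simp_homology q (nerve \<V>)) (nerve_homology_map q g \<U> \<V>)"
proof -
  note cycles = chain.subspace_0[OF subspace_ord_cycles] chain.subspace_add[OF subspace_ord_cycles]
    chain.subspace_scale[OF subspace_ord_cycles] ord_push_cycles[OF carries_contiguous[OF assms assms]]
  note push = chain_linear_0[OF chain_linear_ord_push] chain_linear_add[OF chain_linear_ord_push]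
    chain_linear_scale[OF chain_linear_ord_push]
  show ?thesis
    by (auto simp: lin_map_def carrier_simp_homology zero_simp_homology add_simp_homology
        smult_simp_homology nerve_homology_map_class[OF assms] cycles push)
qed

lemma nerve_homology_map_compose:
  assumes "carries g \<U> \<V> p" "carries h \<V> \<W> p'" "A \<in> carrier (simp_homology q (nerve \<U>))"
  shows "nerve_homology_map q h \<V> \<W> (nerve_homology_map q g \<U> \<V> A)
    = nerve_homology_map q (\<lambda>x. h (g x)) \<U> \<W> A"
proof -
  obtain z where z: "z \<in> ord_cycles q (nerve \<U>)" "A = homology_class q (nerve \<U>) z"
    using assms(3) by (auto simp: carrier_simp_homology)
  show ?thesis
    using z carries_compose[OF assms(1,2)] by (simp add: nerve_homology_map_class[OF assms(1)] nerve_homology_map_class[OF assms(2)]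
        nerve_homology_map_class ord_push_cycles[OF carries_contiguous[OF assms(1,1)]] ord_push_compose)
qed

text \<open>Once \<open>p\<close> is fixed, the map on points no longer enters; this is the source
  of homotopy invariance.\<close>

lemma nerve_homology_map_cong:
  assumes "carries g \<U> \<V> p" "carries h \<U> \<V> p" "A \<in> carrier (simp_homology q (nerve \<U>))"
  shows "nerve_homology_map q g \<U> \<V> A = nerve_homology_map q h \<U> \<V> A"
  using assms by (auto simp: carrier_simp_homology nerve_homology_map_class)

section \<open>Cech homology\<close>

lemma refinement_carries: "(\<forall>U\<in>\<U>. \<exists>V\<in>\<V>. U \<subseteq> V) \<longleftrightarrow> (\<exists>p. carries id \<U> \<V> p)"
proof
  assume "\<forall>U\<in>\<U>. \<exists>V\<in>\<V>. U \<subseteq> V"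
  then have "\<forall>U\<in>\<U>. \<exists>V. V \<in> \<V> \<and> U \<subseteq> V" by blast
  then show "\<exists>p. carries id \<U> \<V> p"
    unfolding carries_def image_id id_apply by (rule bchoice)
qed (auto simp: carries_def)

lemma carrier_cech_homology:
  "x \<in> carrier (cech_homology q T) \<longleftrightarrow>
     x \<in> (\<Pi>\<^sub>E \<U> \<in> finite_open_covers T. carrier (simp_homology q (nerve \<U>))) \<and>
     (\<forall>\<U> \<in> finite_open_covers T. \<forall>\<V> \<in> finite_open_covers T. \<forall>p.
        carries id \<U> \<V> p \<longrightarrow> nerve_homology_map q id \<U> \<V> (x \<U>) = x \<V>)"
  by (simp add: cech_homology_def refinement_carries)

lemma zero_cech_homology:
  "\<zero>\<^bsub>cech_homology q T\<^esub> = (\<lambda>\<U> \<in> finite_open_covers T. \<zero>\<^bsub>simp_homology q (nerve \<U>)\<^esub>)"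
  by (simp add: cech_homology_def)

lemma add_cech_homology:
  "x \<oplus>\<^bsub>cech_homology q T\<^esub> y = (\<lambda>\<U> \<in> finite_open_covers T. x \<U> \<oplus>\<^bsub>simp_homology q (nerve \<U>)\<^esub> y \<U>)"
  by (simp add: cech_homology_def)

lemma smult_cech_homology:
  "k \<odot>\<^bsub>cech_homology q T\<^esub> x = (\<lambda>\<U> \<in> finite_open_covers T. k \<odot>\<^bsub>simp_homology q (nerve \<U>)\<^esub> x \<U>)"
  by (simp add: cech_homology_def)

lemmas cech_homology_ops = zero_cech_homology add_cech_homology smult_cech_homology

lemma cech_closed: "\<lbrakk>x \<in> carrier (cech_homology q T); \<U> \<in> finite_open_covers T\<rbrakk>
    \<Longrightarrow> x \<U> \<in> carrier (simp_homology q (nerve \<U>))"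
  by (auto simp: carrier_cech_homology PiE_def)

lemma cech_refine: "\<lbrakk>x \<in> carrier (cech_homology q T); \<U> \<in> finite_open_covers T;
    \<V> \<in> finite_open_covers T; carries id \<U> \<V> p\<rbrakk> \<Longrightarrow> nerve_homology_map q id \<U> \<V> (x \<U>) = x \<V>"
  by (auto simp: carrier_cech_homology)

lemma cech_eqI:
  assumes "x \<in> extensional (finite_open_covers T)" "y \<in> extensional (finite_open_covers T)"
    and "\<And>\<U>. \<U> \<in> finite_open_covers T \<Longrightarrow> x \<U> = y \<U>"
  shows "x = y"
  using assms by (rule extensionalityI)

lemma cech_extensional: "x \<in> carrier (cech_homology q T) \<Longrightarrow> x \<in> extensional (finite_open_covers T)"
  by (auto simp: carrier_cech_homology PiE_def)

lemma lin_space_cech_homology: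
  fixes T :: "'a topology"
  shows "lin_space (cech_homology q T :: ('k::field, _) module)"
proof -
  let ?H = "cech_homology q T :: ('k, _) module"
  let ?C = "\<lambda>\<U>. simp_homology q (nerve \<U>) :: ('k, ('a set list \<Rightarrow>\<^sub>0 'k) set) module"
  have C: "abelian_monoid (?C \<U>)" and C_smult: "\<And>k x. x \<in> carrier (?C \<U>) \<Longrightarrow> k \<odot>\<^bsub>?C \<U>\<^esub> x \<in> carrier (?C \<U>)" for \<U>
    using lin_space_simp_homology[of q "nerve \<U>", where 'k = 'k] by (auto simp: lin_space_def)
  note C_simps = abelian_monoid.a_closed[OF C] abelian_monoid.zero_closed[OF C] abelian_monoid.l_zero[OF C]
    abelian_monoid.a_assoc[OF C] C_smult
  note lin = lin_mapD[OF lin_map_nerve_homology_map[where q = q]]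
  have "abelian_monoid ?H"
  proof (rule abelian_monoidI)
    fix x y assume x: "x \<in> carrier ?H" and y: "y \<in> carrier ?H"
    show "x \<oplus>\<^bsub>?H\<^esub> y \<in> carrier ?H"
      using x y unfolding carrier_cech_homology[of "x \<oplus>\<^bsub>?H\<^esub> y"]
      by (auto simp: cech_homology_ops cech_closed lin C_simps cech_refine)
    show "x \<oplus>\<^bsub>?H\<^esub> y = y \<oplus>\<^bsub>?H\<^esub> x"
      by (rule cech_eqI[of _ T])
         (auto simp: cech_homology_ops intro!: abelian_monoid.a_comm[OF C] cech_closed x y)
    show "\<zero>\<^bsub>?H\<^esub> \<oplus>\<^bsub>?H\<^esub> x = x"
      by (rule cech_eqI[of _ T])
         (auto simp: cech_homology_ops C_simps cech_closed[OF x] intro: cech_extensional[OF x])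
    fix z assume z: "z \<in> carrier ?H"
    show "x \<oplus>\<^bsub>?H\<^esub> y \<oplus>\<^bsub>?H\<^esub> z = x \<oplus>\<^bsub>?H\<^esub> (y \<oplus>\<^bsub>?H\<^esub> z)"
      by (rule cech_eqI[of _ T])
         (auto simp: cech_homology_ops C_simps cech_closed[OF x] cech_closed[OF y] cech_closed[OF z])
  next
    show "\<zero>\<^bsub>?H\<^esub> \<in> carrier ?H"
      by (auto simp: carrier_cech_homology cech_homology_ops lin C_simps)
  qed
  moreover have "k \<odot>\<^bsub>?H\<^esub> x \<in> carrier ?H" if x: "x \<in> carrier ?H" for k x
    using x unfolding carrier_cech_homology[of "k \<odot>\<^bsub>?H\<^esub> x"]
    by (auto simp: cech_homology_ops cech_closed lin C_simps cech_refine)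
  ultimately show ?thesis
    by (simp add: lin_space_def)
qed

section \<open>Homomorphisms of Cech homology induced by continuous maps\<close>

lemma cover_pullback_in_covers:
  assumes "continuous_map S T g" "\<V> \<in> finite_open_covers T"
  shows "cover_pullback S g \<V> \<in> finite_open_covers S"
proof -
  have "g x \<in> \<Union>\<V>" if "x \<in> topspace S" for x
    using assms that continuous_map_image_subset_topspace by (fastforce simp: finite_open_covers_def)
  then have "\<Union>(cover_pullback S g \<V>) = topspace S"
    by (auto simp: cover_pullback_def)
  moreover have "openin S {x \<in> topspace S. g x \<in> V}" if "V \<in> \<V>" for V
    using assms that by (intro openin_continuous_map_preimage[OF assms(1)]) (auto simp: finite_open_covers_def)
  ultimately show ?thesis
    using assms(2) by (auto simp: finite_open_covers_def cover_pullback_def)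
qed

lemma cover_pullback_carries: "\<exists>p. carries g (cover_pullback S g \<V>) \<V> p"
proof -
  have "\<forall>U\<in>cover_pullback S g \<V>. \<exists>V. V \<in> \<V> \<and> g ` U \<subseteq> V"
    by (auto simp: cover_pullback_def)
  then show ?thesis unfolding carries_def by (rule bchoice)
qed

text \<open>A cover carried into \<open>\<V>\<close> by \<open>g\<close> refines the pullback of
  \<open>\<V>\<close>, and compatibility of \<open>x\<close> then replaces the pullback by that
  cover.\<close>

lemma cech_map_apply:
  assumes g: "continuous_map S T g" and x: "x \<in> carrier (cech_homology q S)"
    and \<V>: "\<V> \<in> finite_open_covers T" and \<W>: "\<W> \<in> finite_open_covers S" and p: "carries g \<W> \<V> p"
  shows "cech_map q S T g x \<V> = nerve_homology_map q g \<W> \<V> (x \<W>)"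
proof -
  let ?P = "cover_pullback S g \<V>"
  have P: "?P \<in> finite_open_covers S" by (rule cover_pullback_in_covers[OF g \<V>])
  obtain p' where p': "carries g ?P \<V> p'" using cover_pullback_carries by blast
  \<comment> \<open>The refinement sends \<open>U\<close> to the preimage of
    \<open>p U\<close>.\<close>
  have "carries id \<W> ?P (\<lambda>U. {x \<in> topspace S. g x \<in> p U})"
    using p \<W> by (force simp: carries_def cover_pullback_def finite_open_covers_def dest: openin_subset)
  note r = this
  have "cech_map q S T g x \<V> = nerve_homology_map q g ?P \<V> (nerve_homology_map q id \<W> ?P (x \<W>))"
    using \<V> cech_refine[OF x \<W> P r] by (simp add: cech_map_def)
  also have "\<dots> = nerve_homology_map q g \<W> \<V> (x \<W>)"
    using nerve_homology_map_compose[OF r p' cech_closed[OF x \<W>]] by simp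
  finally show ?thesis .
qed

lemma lin_map_cech_map:
  fixes g :: "'a \<Rightarrow> 'b"
  assumes g: "continuous_map S T g"
  shows "lin_map (cech_homology q S :: ('k::field, _) module) (cech_homology q T) (cech_map q S T g)"
proof -
  let ?P = "cover_pullback S g" and ?f = "cech_map q S T g :: _ \<Rightarrow> _ \<Rightarrow> ('b set list \<Rightarrow>\<^sub>0 'k) set"
  note P = cover_pullback_in_covers[OF g]
  have lin: "lin_map (simp_homology q (nerve (?P \<V>))) (simp_homology q (nerve \<V>) :: ('k, _) module)
      (nerve_homology_map q g (?P \<V>) \<V>)" for \<V>
    using cover_pullback_carries lin_map_nerve_homology_map by blast
  have ext: "?f x \<in> extensional (finite_open_covers T)" for x
    by (simp add: cech_map_def)
  have "?f x \<in> carrier (cech_homology q T)" if x: "x \<in> carrier (cech_homology q S)" for x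
    unfolding carrier_cech_homology
  proof (intro conjI ballI allI impI)
    show "?f x \<in> (\<Pi>\<^sub>E \<U>\<in>finite_open_covers T. carrier (simp_homology q (nerve \<U>)))"
      using P by (auto simp: cech_map_def cech_closed[OF x] lin_map_closed[OF lin])
    fix \<U> \<V> p assume \<U>: "\<U> \<in> finite_open_covers T" and \<V>: "\<V> \<in> finite_open_covers T"
      and p: "carries id \<U> \<V> p"
    \<comment> \<open>Both values are read off from the pullback of the finer cover
      \<open>\<U>\<close>, which is carried into \<open>\<V>\<close> by way of
      \<open>\<U>\<close>.\<close>
    obtain r where r: "carries g (?P \<U>) \<U> r" using cover_pullback_carries by blast
    have "carries g (?P \<U>) \<V> (\<lambda>U. p (r U))"
      using carries_compose[OF r p] by simp
    then have "?f x \<V> = nerve_homology_map q g (?P \<U>) \<V> (x (?P \<U>))"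
      by (rule cech_map_apply[OF g x \<V> P[OF \<U>]])
    then show "nerve_homology_map q id \<U> \<V> (?f x \<U>) = ?f x \<V>"
      using nerve_homology_map_compose[OF r p cech_closed[OF x P[OF \<U>]]] \<U>
      by (simp add: cech_map_def)
  qed
  moreover have "?f \<zero>\<^bsub>cech_homology q S\<^esub> = \<zero>\<^bsub>cech_homology q T\<^esub>"
    by (rule cech_eqI[OF ext])
       (auto simp: cech_map_def cech_homology_ops P lin_map_zero[OF lin])
  moreover have "?f (x \<oplus>\<^bsub>cech_homology q S\<^esub> y) = ?f x \<oplus>\<^bsub>cech_homology q T\<^esub> ?f y"
    if x: "x \<in> carrier (cech_homology q S)" and y: "y \<in> carrier (cech_homology q S)" for x y
    by (rule cech_eqI[OF ext])
       (auto simp: cech_map_def cech_homology_ops P lin_map_add[OF lin] cech_closed[OF x] cech_closed[OF y])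
  moreover have "?f (k \<odot>\<^bsub>cech_homology q S\<^esub> x) = k \<odot>\<^bsub>cech_homology q T\<^esub> ?f x"
    if x: "x \<in> carrier (cech_homology q S)" for k x
    by (rule cech_eqI[OF ext])
       (auto simp: cech_map_def cech_homology_ops P lin_map_smult[OF lin] cech_closed[OF x])
  ultimately show ?thesis
    by (simp add: lin_map_def)
qed

lemma cech_map_compose:
  assumes g: "continuous_map S T g" and h: "continuous_map T R h"
    and x: "x \<in> carrier (cech_homology q S)"
  shows "cech_map q T R h (cech_map q S T g x) = cech_map q S R (\<lambda>x. h (g x)) x"
proof (rule cech_eqI[of _ R])
  fix \<V> assume \<V>: "\<V> \<in> finite_open_covers R"
  \<comment> \<open>Pulling back in two stages gives one cover of \<open>S\<close> from which both
    sides at \<open>\<V>\<close> can be computed.\<close>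
  let ?Q = "cover_pullback T h \<V>"
  let ?P = "cover_pullback S g ?Q"
  have Q: "?Q \<in> finite_open_covers T" by (rule cover_pullback_in_covers[OF h \<V>])
  have P: "?P \<in> finite_open_covers S" by (rule cover_pullback_in_covers[OF g Q])
  obtain p r where p: "carries g ?P ?Q p" and r: "carries h ?Q \<V> r"
    using cover_pullback_carries by metis
  note c = carries_compose[OF p r]
  have hg: "continuous_map S R (\<lambda>x. h (g x))"
    using continuous_map_compose[OF g h] by (simp add: comp_def)
  show "cech_map q T R h (cech_map q S T g x) \<V> = cech_map q S R (\<lambda>x. h (g x)) x \<V>"
    using nerve_homology_map_compose[OF p r cech_closed[OF x P]] \<V> Q
    by (simp add: cech_map_apply[OF hg x \<V> P c]) (simp add: cech_map_def)
qed (simp_all add: cech_map_def)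

lemma cech_map_eqI:
  assumes g: "continuous_map S T g" and h: "continuous_map S T h"
    and x: "x \<in> carrier (cech_homology q S)"
    and "\<And>\<V>. \<V> \<in> finite_open_covers T \<Longrightarrow> \<exists>\<W>\<in>finite_open_covers S. \<exists>p. carries g \<W> \<V> p \<and> carries h \<W> \<V> p"
  shows "cech_map q S T g x = cech_map q S T h x"
proof (rule cech_eqI[of _ T])
  fix \<V> assume \<V>: "\<V> \<in> finite_open_covers T"
  then obtain \<W> p where \<W>: "\<W> \<in> finite_open_covers S" "carries g \<W> \<V> p" "carries h \<W> \<V> p"
    using assms(4) by blast
  then show "cech_map q S T g x \<V> = cech_map q S T h x \<V>"
    using cech_map_apply[OF g x \<V> \<W>(1,2)] cech_map_apply[OF h x \<V> \<W>(1,3)]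
      nerve_homology_map_cong[OF \<W>(2,3) cech_closed[OF x \<W>(1)]] by simp
qed (simp_all add: cech_map_def)

lemma cech_map_cong:
  assumes g: "continuous_map S T g" and gh: "\<And>a. a \<in> topspace S \<Longrightarrow> g a = h a"
    and x: "x \<in> carrier (cech_homology q S)"
  shows "cech_map q S T g x = cech_map q S T h x"
proof (rule cech_map_eqI[OF g continuous_map_eq[OF g gh] x])
  fix \<V> assume \<V>: "\<V> \<in> finite_open_covers T"
  obtain p where p: "carries g (cover_pullback S g \<V>) \<V> p" using cover_pullback_carries by blast
  have "h ` U = g ` U" if "U \<in> cover_pullback S g \<V>" for U
    using that gh by (auto simp: cover_pullback_def)
  then have "carries h (cover_pullback S g \<V>) \<V> p"
    using p by (simp add: carries_def)
  then show "\<exists>\<W>\<in>finite_open_covers S. \<exists>p. carries g \<W> \<V> p \<and> carries h \<W> \<V> p"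
    using p cover_pullback_in_covers[OF g \<V>] by blast
qed

section \<open>Homotopy invariance\<close>

text \<open>\<open>e\<close> is half a Lebesgue number of \<open>\<V>\<close>. Where
  \<open>g\<close> stays within \<open>e\<close> of a centre in \<open>B\<close>, \<open>h\<close>
  stays within \<open>2 * e\<close>, so one member of \<open>\<V>\<close> contains both images. The
  bound does not depend on the maps.\<close>

lemma common_carrying_cover:
  fixes A :: "'a::topological_space set" and B :: "'b::metric_space set"
  assumes "compact B" "\<V> \<in> finite_open_covers (top_of_set B)"
  obtains e where "e > 0"
    "\<And>g h. \<lbrakk>continuous_on A g; g ` A \<subseteq> B; h ` A \<subseteq> B; \<And>x. x \<in> A \<Longrightarrow> dist (g x) (h x) < e\<rbrakk>
      \<Longrightarrow> \<exists>\<W>\<in>finite_open_covers (top_of_set A). \<exists>p. carries g \<W> \<V> p \<and> carries h \<W> \<V> p"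
proof -
  \<comment> \<open>Members of \<open>\<V>\<close> are open in \<open>B\<close> only;
    \<open>\<G>\<close> extends them to open sets of the ambient space.\<close>
  define \<G> where "\<G> = {G. open G \<and> B \<inter> G \<in> \<V>}"
  have cov: "B \<subseteq> \<Union>\<G>"
  proof
    fix b assume "b \<in> B"
    then obtain V where V: "V \<in> \<V>" "b \<in> V" "openin (top_of_set B) V"
      using assms(2) by (auto simp: finite_open_covers_def)
    then obtain G where "open G" "V = B \<inter> G" by (auto simp: openin_open)
    then show "b \<in> \<Union>\<G>" using V by (auto simp: \<G>_def)
  qed
  have opn: "open G" if "G \<in> \<G>" for G
    using that by (simp add: \<G>_def)
  obtain d where d: "d > 0" "\<And>x. x \<in> B \<Longrightarrow> \<exists>G\<in>\<G>. ball x d \<subseteq> G"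
    by (rule Heine_Borel_lemma[OF assms(1) cov opn]) (blast intro: that)+
  \<comment> \<open>Compactness leaves finitely many centres, so the \<open>g\<close>-preimages of
    their balls form a finite cover.\<close>
  obtain C where C: "finite C" "C \<subseteq> B" "B \<subseteq> (\<Union>c\<in>C. ball c (d / 2))"
    using compactE_image[OF assms(1), of B "\<lambda>c. ball c (d / 2)"] d(1) by force
  show ?thesis
  proof (rule that[of "d / 2"])
    show "d / 2 > 0" using d(1) by simp
    fix g h :: "'a \<Rightarrow> 'b"
    assume g: "continuous_on A g" "g ` A \<subseteq> B" and h: "h ` A \<subseteq> B"
      and gh: "\<And>x. x \<in> A \<Longrightarrow> dist (g x) (h x) < d / 2"
    define W where "W c = A \<inter> g -` ball c (d / 2)" for c
    have "openin (top_of_set A) (W c)" for c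
      unfolding W_def by (rule continuous_openin_preimage_gen[OF g(1) open_ball])
    moreover have "\<Union>(W ` C) = A"
      using C(3) g(2) by (fastforce simp: W_def)
    ultimately have cover: "W ` C \<in> finite_open_covers (top_of_set A)"
      using C(1) by (auto simp: finite_open_covers_def)
    have "\<forall>U\<in>W ` C. \<exists>V. V \<in> \<V> \<and> g ` U \<subseteq> V \<and> h ` U \<subseteq> V"
    proof
      fix U assume "U \<in> W ` C"
      then obtain c where c: "c \<in> C" "U = W c" by blast
      then obtain G where G: "G \<in> \<G>" "ball c d \<subseteq> G" using C(2) d(2) by blast
      have "g x \<in> ball c d \<and> h x \<in> ball c d" if "x \<in> W c" for x
      proof -
        have "x \<in> A" "dist c (g x) < d / 2" using that by (auto simp: W_def)
        then show ?thesis
          using gh[of x] dist_triangle[of c "h x" "g x"] d(1) by auto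
      qed
      then have "g ` U \<subseteq> B \<inter> G \<and> h ` U \<subseteq> B \<inter> G"
        using c(2) G(2) g(2) h by (auto simp: W_def)
      then show "\<exists>V. V \<in> \<V> \<and> g ` U \<subseteq> V \<and> h ` U \<subseteq> V"
        using G(1) by (intro exI[of _ "B \<inter> G"]) (simp add: \<G>_def)
    qed
    from bchoice[OF this] obtain p where "\<forall>U\<in>W ` C. p U \<in> \<V> \<and> g ` U \<subseteq> p U \<and> h ` U \<subseteq> p U" ..
    then have "carries g (W ` C) \<V> p \<and> carries h (W ` C) \<V> p"
      unfolding carries_def by simp
    with cover show "\<exists>\<W>\<in>finite_open_covers (top_of_set A). \<exists>p. carries g \<W> \<V> p \<and> carries h \<W> \<V> p"
      by (intro bexI[of _ "W ` C"] exI[of _ p])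
  qed
qed

text \<open>The closeness \<open>e\<close> depends on the cover, so the cover is fixed first; the
  number of small steps into which the homotopy is cut may then vary with it.\<close>

lemma cech_map_homotopy:
  fixes A :: "'a::metric_space set" and B :: "'b::metric_space set" and H :: "real \<times> 'a \<Rightarrow> 'b"
  assumes A: "compact A" and B: "compact B" and H: "continuous_on ({0..1} \<times> A) H" "H ` ({0..1} \<times> A) \<subseteq> B"
    and x: "x \<in> carrier (cech_homology q (top_of_set A))"
  shows "cech_map q (top_of_set A) (top_of_set B) (\<lambda>a. H (0, a)) x
    = cech_map q (top_of_set A) (top_of_set B) (\<lambda>a. H (1, a)) x"
proof (rule cech_eqI[of _ "top_of_set B"])
  fix \<V> assume \<V>: "\<V> \<in> finite_open_covers (top_of_set B)"
  let ?f = "\<lambda>t. cech_map q (top_of_set A) (top_of_set B) (\<lambda>a. H (t, a)) x \<V>"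
  obtain e where e: "e > 0"
    "\<And>g h. \<lbrakk>continuous_on A g; g ` A \<subseteq> B; h ` A \<subseteq> B; \<And>x. x \<in> A \<Longrightarrow> dist (g x) (h x) < e\<rbrakk>
      \<Longrightarrow> \<exists>\<W>\<in>finite_open_covers (top_of_set A). \<exists>p. carries g \<W> \<V> p \<and> carries h \<W> \<V> p"
    using common_carrying_cover[OF B \<V>] by metis
  have cont: "continuous_on A (\<lambda>a. H (t, a))" "(\<lambda>a. H (t, a)) ` A \<subseteq> B" if "t \<in> {0..1}" for t
    using that H(2) by (auto intro!: continuous_on_compose2[OF H(1)] continuous_intros)
  then have map: "continuous_map (top_of_set A) (top_of_set B) (\<lambda>a. H (t, a))" if "t \<in> {0..1}" for t
    using that by (simp add: image_subset_iff_funcset)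
  have "uniformly_continuous_on ({0..1} \<times> A) H"
    by (intro compact_uniformly_continuous H(1) compact_Times A compact_Icc)
  then obtain d where d: "d > 0"
    "\<And>y z. \<lbrakk>y \<in> {0..1} \<times> A; z \<in> {0..1} \<times> A; dist z y < d\<rbrakk> \<Longrightarrow> dist (H z) (H y) < e"
    unfolding uniformly_continuous_on_def using e(1) by metis
  have step: "?f s = ?f t" if st: "s \<in> {0..1}" "t \<in> {0..1}" "dist s t < d" for s t
  proof -
    have "\<exists>\<W>\<in>finite_open_covers (top_of_set A). \<exists>p. carries (\<lambda>a. H (s, a)) \<W> \<V> p \<and> carries (\<lambda>a. H (t, a)) \<W> \<V> p"
      using st cont by (intro e(2) d(2)) (auto simp: dist_Pair_Pair)
    then obtain \<W> p where W: "\<W> \<in> finite_open_covers (top_of_set A)"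
      "carries (\<lambda>a. H (s, a)) \<W> \<V> p" "carries (\<lambda>a. H (t, a)) \<W> \<V> p" by blast
    then show ?thesis
      using cech_map_apply[OF map[OF st(1)] x \<V> W(1,2)] cech_map_apply[OF map[OF st(2)] x \<V> W(1,3)]
        nerve_homology_map_cong[OF W(2,3) cech_closed[OF x W(1)]] by simp
  qed
  obtain n where n: "n > 0" "1 / real n < d"
    using d(1) by (metis nat_approx_posE zero_less_Suc)
  have "?f 0 = ?f (real k / real n)" if "k \<le> n" for k
    using that
  proof (induction k)
    case (Suc k)
    have "?f (real k / real n) = ?f (real (Suc k) / real n)"
      using Suc.prems n by (intro step) (auto simp: dist_real_def divide_simps)
    then show ?case using Suc by simp
  qed simp
  from this[of n] show "?f 0 = ?f 1" using n(1) by simp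
qed (simp_all add: cech_map_def)

section \<open>Persistent Betti numbers\<close>

text \<open>On homology the inclusion for \<open>Z\<close> factors as \<open>g\<close>, the
  inclusion for \<open>Y\<close>, then \<open>h\<close>. The rank of a composite is at most that of
  its middle map.\<close>

lemma pers_betti_factor:
  fixes g :: "'a::topological_space \<Rightarrow> 'b::topological_space" and h :: "'b \<Rightarrow> 'a"
    and f :: "'a \<Rightarrow> real^'n" and f' :: "'b \<Rightarrow> real^'l"
  assumes g: "continuous_on (sublevel Z f u) g" "g ` sublevel Z f u \<subseteq> sublevel Y f' u'"
    and h: "continuous_on (sublevel Y f' v') h" "h ` sublevel Y f' v' \<subseteq> sublevel Z f v"
    and Y: "sublevel Y f' u' \<subseteq> sublevel Y f' v'"
    and hg: "\<And>x :: _ \<Rightarrow> (_ \<Rightarrow>\<^sub>0 'k::field) set. x \<in> carrier (cech_homology i (top_of_set (sublevel Z f u)))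
      \<Longrightarrow> cech_map i (top_of_set (sublevel Z f u)) (top_of_set (sublevel Z f v)) id x
        = cech_map i (top_of_set (sublevel Z f u)) (top_of_set (sublevel Z f v)) (\<lambda>x. h (g x)) x"
  shows "pers_betti TYPE('k) i Z f (u, v) \<le> pers_betti TYPE('k) i Y f' (u', v')"
proof -
  let ?A = "top_of_set (sublevel Z f u)" and ?B = "top_of_set (sublevel Z f v)"
  let ?C = "top_of_set (sublevel Y f' u')" and ?D = "top_of_set (sublevel Y f' v')"
  have g: "continuous_map ?A ?C g" and h: "continuous_map ?D ?B h" and id: "continuous_map ?C ?D id"
    using g h Y by (auto simp: image_subset_iff_funcset)
  note lin_id = lin_map_closed[OF lin_map_cech_map[OF id]] and lin_g = lin_map_closed[OF lin_map_cech_map[OF g]]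
  have "cech_map i ?A ?B id x \<in> cech_map i ?D ?B h ` cech_map i ?C ?D id ` carrier (cech_homology i ?C)"
    if x: "x \<in> carrier (cech_homology i ?A)" for x :: "_ \<Rightarrow> (_ \<Rightarrow>\<^sub>0 'k) set"
  proof -
    have "cech_map i ?A ?B id x = cech_map i ?D ?B h (cech_map i ?C ?D id (cech_map i ?A ?C g x))"
      using hg[OF x] cech_map_compose[OF id h lin_g[OF x]]
        cech_map_compose[OF g continuous_map_compose[OF id h] x] by (simp add: comp_def)
    then show ?thesis using lin_g[OF x] by blast
  qed
  then show ?thesis
    unfolding pers_betti_def Let_def prod.case
    using lin_id
    by (intro subspace_dim_factor[OF lin_space_cech_homology lin_space_cech_homology lin_map_cech_map[OF h]]) auto
qed

section \<open>The tubular neighbourhood\<close>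

definition normal_at :: "'a::euclidean_space set \<Rightarrow> 'a \<Rightarrow> 'a \<Rightarrow> bool" where
  "normal_at X x w \<longleftrightarrow> (\<forall>\<xi>\<in>tangent_space X x. w \<bullet> \<xi> = 0)"

lemma normal_at_scaleR: "normal_at X x w \<Longrightarrow> normal_at X x (r *\<^sub>R w)"
  by (simp add: normal_at_def)

text \<open>Along a curve in \<open>X\<close> through \<open>x\<close> the squared distance to
  \<open>p\<close> is minimal at \<open>0\<close>, so its derivative there,
  \<open>- 2 * ((p - x) \<bullet> \<xi>)\<close>, vanishes.\<close>

lemma nearest_point_normal:
  assumes "\<And>y. y \<in> X \<Longrightarrow> dist p x \<le> dist p y"
  shows "normal_at X x (p - x)"
  unfolding normal_at_def
proof
  fix \<xi> assume "\<xi> \<in> tangent_space X x"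
  then obtain \<gamma> :: "real \<Rightarrow> 'a" and e where \<gamma>: "e > 0" "\<gamma> ` {-e<..<e} \<subseteq> X" "\<gamma> 0 = x"
      "(\<gamma> has_vector_derivative \<xi>) (at 0)"
    by (auto simp: tangent_space_def)
  have "((\<lambda>t. p - \<gamma> t) has_derivative (\<lambda>h. - (h *\<^sub>R \<xi>))) (at 0)"
    using \<gamma>(4) unfolding has_vector_derivative_def
    by (auto intro!: derivative_eq_intros)
  from has_derivative_inner[OF this this]
  have "((\<lambda>t. (p - \<gamma> t) \<bullet> (p - \<gamma> t)) has_real_derivative - 2 * ((p - x) \<bullet> \<xi>)) (at 0)"
    unfolding has_field_derivative_def
    by (rule has_derivative_eq_rhs) (auto simp: fun_eq_iff \<gamma>(3) inner_commute algebra_simps)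
  then have "- 2 * ((p - x) \<bullet> \<xi>) = 0"
  proof (rule DERIV_local_min[OF _ \<gamma>(1)], intro allI impI)
    fix t :: real assume "\<bar>0 - t\<bar> < e"
    then have "\<gamma> t \<in> X" using \<gamma>(2) by (auto simp: abs_less_iff image_subset_iff)
    then show "(p - \<gamma> 0) \<bullet> (p - \<gamma> 0) \<le> (p - \<gamma> t) \<bullet> (p - \<gamma> t)"
      using assms[of "\<gamma> t"] by (simp add: \<gamma>(3) dist_norm norm_le)
  qed
  then show "(p - x) \<bullet> \<xi> = 0" by simp
qed

text \<open>Injectivity of \<open>(x, v) -> x + v\<close> on normal vectors shorter than
  \<open>\<tau>\<close>; equal foot points force equal vectors.\<close>

definition reach_at_least :: "'a::euclidean_space set \<Rightarrow> real \<Rightarrow> bool" where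
  "reach_at_least X \<tau> \<longleftrightarrow> (\<forall>x\<in>X. \<forall>y\<in>X. \<forall>v w. normal_at X x v \<and> normal_at X y w \<and>
     norm v < \<tau> \<and> norm w < \<tau> \<and> x + v = y + w \<longrightarrow> x = y)"

lemma condition_number_reach:
  assumes "has_condition_number X (1 / \<tau>)"
  shows "\<tau> > 0" "reach_at_least X \<tau>"
proof -
  obtain \<tau>' where \<tau>': "\<tau>' > 0" "1 / \<tau> = 1 / \<tau>'" "normal_bundle_embedded_below X \<tau>'"
    using assms by (auto simp: has_condition_number_def)
  \<comment> \<open>\<open>1 / (1 / t) = t\<close> holds for every real \<open>t\<close>, including
    \<open>0\<close>, so equal reciprocals give equal numbers before \<open>\<tau> > 0\<close> is
    known.\<close>
  then have eq: "\<tau>' = \<tau>" by (metis divide_divide_eq_right mult_1 div_by_1)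
  show "\<tau> > 0" using \<tau>'(1) eq by simp
  show "reach_at_least X \<tau>"
    unfolding reach_at_least_def
  proof (intro ballI allI impI, elim conjE)
    fix x y v w
    assume xy: "x \<in> X" "y \<in> X" "normal_at X x v" "normal_at X y w" "norm v < \<tau>" "norm w < \<tau>"
      and sum: "x + v = y + w"
    \<comment> \<open>The embedding is given for radii strictly below \<open>\<tau>\<close>; both
      norms fit under such a radius.\<close>
    obtain s where s: "norm v < s" "norm w < s" "s < \<tau>"
      using dense[of "max (norm v) (norm w)" \<tau>] xy by auto
    have "smooth_embedding_on (normal_bundle X s) (\<lambda>(p, w). p + w)"
      using \<tau>'(3) s(3) eq by (simp add: normal_bundle_embedded_below_def)
    then obtain h where "homeomorphism (normal_bundle X s) ((\<lambda>(p, w). p + w) ` normal_bundle X s) (\<lambda>(p, w). p + w) h"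
      by (auto simp: smooth_embedding_on_def)
    then have h: "\<And>z. z \<in> normal_bundle X s \<Longrightarrow> h ((\<lambda>(p, w). p + w) z) = z"
      by (simp add: homeomorphism_def)
    have "(x, v) \<in> normal_bundle X s" "(y, w) \<in> normal_bundle X s"
      using xy s by (auto simp: normal_bundle_def normal_at_def)
    then have "(x, v) = (y, w)"
      using h[of "(x, v)"] h[of "(y, w)"] sum by simp
    then show "x = y" by simp
  qed
qed

text \<open>A nearest point \<open>z\<close> of \<open>x + w\<close> gives a second normal vector
  ending there, no longer than \<open>w\<close>; the reach condition forces
  \<open>z = x\<close>.\<close>

lemma reach_nearest:
  assumes "reach_at_least X \<tau>" "closed X" "x \<in> X" "normal_at X x w" "norm w < \<tau>" "y \<in> X"
  shows "norm w \<le> dist (x + w) y"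
proof -
  obtain z where z: "z \<in> X" "\<And>y. y \<in> X \<Longrightarrow> dist (x + w) z \<le> dist (x + w) y"
    using distance_attains_inf[of X "x + w"] assms(2,3) by blast
  have "normal_at X z (x + w - z)" by (rule nearest_point_normal[OF z(2)])
  moreover have "norm (x + w - z) < \<tau>"
    using z(2)[OF assms(3)] assms(5) by (simp add: dist_norm)
  moreover have "x + w = z + (x + w - z)" by simp
  ultimately have "x = z"
    using assms z(1) unfolding reach_at_least_def by blast
  then show ?thesis using z(2)[OF assms(6)] by (simp add: dist_norm)
qed

section \<open>Tangent balls and the segment to the nearest point\<close>

lemma norm_scaleR_diff_sq:
  fixes n v :: "'a::real_inner"
  assumes "norm n = 1"
  shows "(norm (s *\<^sub>R n - v))\<^sup>2 = (norm v)\<^sup>2 - 2 * s * (v \<bullet> n) + s\<^sup>2"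
  using assms unfolding power2_norm_eq_inner norm_eq_1
  by (simp add: inner_diff_left inner_diff_right inner_commute power2_eq_square)

text \<open>Open balls of radius \<open>s < \<tau>\<close> tangent to \<open>X\<close> at
  \<open>x\<close> miss \<open>X\<close>; the claim is the limit of this inequality as
  \<open>s\<close> approaches \<open>\<tau>\<close>.\<close>

lemma reach_inner_le:
  assumes "reach_at_least X \<tau>" "\<tau> > 0" "closed X" "x \<in> X" "normal_at X x n" "norm n = 1" "y \<in> X"
  shows "2 * \<tau> * ((y - x) \<bullet> n) \<le> (norm (y - x))\<^sup>2"
proof (rule ccontr)
  let ?c = "(y - x) \<bullet> n" and ?N = "(norm (y - x))\<^sup>2"
  assume "\<not> 2 * \<tau> * ?c \<le> ?N"
  then have c: "?N < 2 * \<tau> * ?c" by simp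
  moreover have "0 \<le> ?N" by simp
  ultimately have c0: "?c > 0"
    using assms(2) by (smt (verit) mult_nonneg_nonpos)
  then have "?N / (2 * ?c) < \<tau>" using c by (simp add: field_simps)
  \<comment> \<open>A violation leaves room for a radius \<open>s\<close> below
    \<open>\<tau>\<close> such that the open ball around \<open>x + s n\<close> contains
    \<open>y\<close>.\<close>
  then obtain s where s: "?N / (2 * ?c) < s" "s < \<tau>" using dense by blast
  have "0 \<le> ?N / (2 * ?c)" using c0 by simp
  then have s0: "s > 0" using s(1) by linarith
  have "s \<le> norm (s *\<^sub>R n - (y - x))"
    using reach_nearest[OF assms(1,3,4) normal_at_scaleR[OF assms(5), of s] _ assms(7)] s(2) s0 assms(6)
    by (simp add: dist_norm algebra_simps)
  then have "s\<^sup>2 \<le> (norm (s *\<^sub>R n - (y - x)))\<^sup>2"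
    using s0 by (intro power_mono) auto
  also have "\<dots> = s\<^sup>2 - 2 * s * ?c + ?N"
    using norm_scaleR_diff_sq[OF assms(6)] by simp
  finally have "2 * s * ?c \<le> ?N" by simp
  then show False using s(1) c0 by (simp add: field_simps)
qed

text \<open>
  With \<open>n\<close> the unit normal at \<open>x\<close> pointing to \<open>p = x + a n\<close>, these are \<open>c = (l - x) \<bullet> n\<close>,
  \<open>N = |l - x|\<^sup>2\<close> for a centre \<open>l\<close> with \<open>|p - l| \<le> \<delta>\<close>, and \<open>c'\<close>, \<open>N'\<close> for a centre \<open>l'\<close> with
  \<open>|x - l'| < \<delta> / 2\<close>. The conclusion says that \<open>x + t n\<close> lies in one of the two balls.
\<close>

lemma two_balls_cover:
  fixes \<tau> \<delta> a t c N c' N' :: real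
  assumes "\<tau> > 0" "\<delta> > 0" "\<delta>\<^sup>2 < 3 / 5 * \<tau>\<^sup>2" "0 \<le> t" "t \<le> a" "a \<le> \<delta>"
    and N: "N - 2 * a * c + a\<^sup>2 \<le> \<delta>\<^sup>2" "2 * \<tau> * c \<le> N"
    and N': "- 2 * \<tau> * c' \<le> N'" "N' \<le> \<delta>\<^sup>2 / 4"
  shows "N - 2 * t * c + t\<^sup>2 \<le> \<delta>\<^sup>2 \<or> N' - 2 * t * c' + t\<^sup>2 \<le> \<delta>\<^sup>2"
proof (rule disjCI)
  assume "\<not> N' - 2 * t * c' + t\<^sup>2 \<le> \<delta>\<^sup>2"
  then have "\<tau> * (N' - 2 * t * c' + t\<^sup>2) > \<tau> * \<delta>\<^sup>2" using assms(1) by simp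
  moreover have "t * (- 2 * \<tau> * c') \<le> t * N'" using N'(1) assms(4) by (rule mult_left_mono)
  moreover have "(\<tau> + t) * N' \<le> (\<tau> + t) * (\<delta>\<^sup>2 / 4)"
    using N'(2) assms(1,4) by (intro mult_left_mono) auto
  \<comment> \<open>If \<open>x + t n\<close> escapes the ball around \<open>l'\<close>, then
    \<open>t\<close> cannot be too small.\<close>
  ultimately have t: "\<delta>\<^sup>2 * (3 * \<tau> - t) < 4 * \<tau> * t\<^sup>2" by (simp add: algebra_simps)
  have "\<delta>\<^sup>2 < \<tau>\<^sup>2" using assms(1,3) zero_less_power[OF assms(1), of 2] by linarith
  then have "\<delta> < \<tau>" using assms(1) by (simp add: power2_less_imp_less)
  then have a\<tau>: "a < \<tau>" "t < \<tau>" using assms by auto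
  \<comment> \<open>From \<open>2 / 5 * \<tau>\<close> on the right side is at least
    \<open>16 / 25 * \<tau>\<^sup>2\<close>, which exceeds \<open>3 / 5 * \<tau>\<^sup>2\<close>.
    For smaller \<open>t\<close> the bound just found suffices, as \<open>2 * \<tau> - 3 * t\<close>
    is positive.\<close>
  have "\<delta>\<^sup>2 \<le> 2 * t * \<tau> - t\<^sup>2"
  proof (cases "t \<ge> 2 / 5 * \<tau>")
    case True
    then have "0 \<le> (t - 2 / 5 * \<tau>) * (8 / 5 * \<tau> - t)"
      using a\<tau> assms(1) by (intro mult_nonneg_nonneg) auto
    also have "\<dots> = 2 * t * \<tau> - t\<^sup>2 - 16 / 25 * \<tau>\<^sup>2"
      by (simp add: power2_eq_square field_simps)
    finally show ?thesis using assms(3) zero_le_power2[of \<tau>] by linarith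
  next
    case False
    then have "0 \<le> 3 * \<tau> * (2 * \<tau> - 3 * t) + t\<^sup>2"
      using assms(1) by (intro add_nonneg_nonneg mult_nonneg_nonneg) auto
    then have "0 \<le> t * (3 * \<tau> * (2 * \<tau> - 3 * t) + t\<^sup>2)"
      using assms(4) by simp
    also have "\<dots> = (2 * t * \<tau> - t\<^sup>2) * (3 * \<tau> - t) - 4 * \<tau> * t\<^sup>2"
      by (simp add: power2_eq_square algebra_simps)
    finally have "\<delta>\<^sup>2 * (3 * \<tau> - t) < (2 * t * \<tau> - t\<^sup>2) * (3 * \<tau> - t)"
      using t by linarith
    then show ?thesis
      using a\<tau>(2) assms(1) by (simp add: mult_less_cancel_right)
  qed
  \<comment> \<open>This product is the difference of \<open>(a + t) * (\<tau> - a)\<close> and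
    \<open>2 * t * \<tau> - t\<^sup>2 - a\<^sup>2\<close>.\<close>
  moreover have "0 \<le> (a - t) * (\<tau> - t)"
    using a\<tau> assms by (intro mult_nonneg_nonneg) auto
  moreover have "2 * c * (\<tau> - a) \<le> \<delta>\<^sup>2 - a\<^sup>2"
    using N by (simp add: algebra_simps)
  ultimately have "2 * c * (\<tau> - a) \<le> (a + t) * (\<tau> - a)"
    by (simp add: power2_eq_square algebra_simps)
  then have "2 * c \<le> a + t" using a\<tau> by simp
  \<comment> \<open>The drop of the squared distance to \<open>l\<close> between parameters
    \<open>a\<close> and \<open>t\<close>: moving back from \<open>p\<close> to
    \<open>x + t n\<close> does not leave the ball around \<open>l\<close>.\<close>
  then have "0 \<le> (a - t) * (a + t - 2 * c)" using assms by simp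
  then show "N - 2 * t * c + t\<^sup>2 \<le> \<delta>\<^sup>2"
    using N(1) by (simp add: power2_eq_square algebra_simps)
qed

text \<open>One centre \<open>l\<close> has \<open>p\<close> in its ball, another,
  \<open>l'\<close>, is close to the nearest point \<open>x\<close>. Expanding squared distances
  along the unit normal from \<open>x\<close> to \<open>p\<close> leaves the real inequality
  \<open>two_balls_cover\<close>.\<close>

lemma segment_to_nearest_point:
  fixes X L :: "'a::euclidean_space set"
  assumes "reach_at_least X \<tau>" "\<tau> > 0" "closed X" "\<delta> > 0" "\<delta>\<^sup>2 < 3 / 5 * \<tau>\<^sup>2"
    and "L \<subseteq> X" "\<And>p. p \<in> X \<Longrightarrow> \<exists>l\<in>L. norm (p - l) < \<delta> / 2"
    and x: "x \<in> X" "\<And>y. y \<in> X \<Longrightarrow> dist p x \<le> dist p y"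
    and p: "p \<in> (\<Union>l\<in>L. cball l \<delta>)"
  shows "closed_segment x p \<subseteq> (\<Union>l\<in>L. cball l \<delta>)"
proof
  fix z assume "z \<in> closed_segment x p"
  then obtain r where r: "0 \<le> r" "r \<le> 1" "z = x + r *\<^sub>R (p - x)"
    by (auto simp: in_segment algebra_simps)
  show "z \<in> (\<Union>l\<in>L. cball l \<delta>)"
  proof (cases "p = x")
    case True
    then show ?thesis using p r by simp
  next
    case False
    obtain l where l: "l \<in> L" "norm (p - l) \<le> \<delta>" using p by (auto simp: dist_norm norm_minus_commute)
    obtain l' where l': "l' \<in> L" "norm (x - l') < \<delta> / 2" using assms(7)[OF x(1)] by blast
    define a where "a = norm (p - x)"
    define n where "n = (1 / a) *\<^sub>R (p - x)"
    have a: "a > 0" "p - x = a *\<^sub>R n" "norm n = 1" using False by (auto simp: a_def n_def)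
    \<comment> \<open>Tangent balls on both sides are used: the one along \<open>n\<close>
      constrains \<open>l\<close>, the one along \<open>- n\<close> constrains
      \<open>l'\<close>.\<close>
    have n: "normal_at X x n" "normal_at X x (- n)"
      using normal_at_scaleR[OF nearest_point_normal[OF x(2)]]
        normal_at_scaleR[of X x "p - x" "- 1 / a"] nearest_point_normal[OF x(2)]
      by (auto simp: n_def)
    have expand: "(norm (s *\<^sub>R n - v))\<^sup>2 = (norm v)\<^sup>2 - 2 * s * (v \<bullet> n) + s\<^sup>2" for s v
      by (rule norm_scaleR_diff_sq[OF a(3)])
    have lX: "l \<in> X" "l' \<in> X" using l l' assms(6) by auto
    have "a \<le> \<delta>" using x(2)[OF lX(1)] l(2) by (simp add: a_def dist_norm)
    moreover have "(norm (l - x))\<^sup>2 - 2 * a * ((l - x) \<bullet> n) + a\<^sup>2 \<le> \<delta>\<^sup>2"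
      using l(2) a(2) assms(4) unfolding expand[symmetric] by (intro power_mono) (auto simp: algebra_simps)
    moreover have "2 * \<tau> * ((l - x) \<bullet> n) \<le> (norm (l - x))\<^sup>2"
      by (rule reach_inner_le[OF assms(1-3) x(1) n(1) a(3) lX(1)])
    moreover have "- 2 * \<tau> * ((l' - x) \<bullet> n) \<le> (norm (l' - x))\<^sup>2"
      using reach_inner_le[OF assms(1-3) x(1) n(2) _ lX(2)] a(3) by simp
    moreover have "(norm (l' - x))\<^sup>2 \<le> \<delta>\<^sup>2 / 4"
      using power_mono[of "norm (l' - x)" "\<delta> / 2" 2] l'(2) by (simp add: norm_minus_commute power_divide)
    moreover have "0 \<le> r * a" "r * a \<le> a" using r a by (auto simp: mult_le_cancel_right1)
    ultimately have "(norm ((r * a) *\<^sub>R n - (l - x)))\<^sup>2 \<le> \<delta>\<^sup>2 \<or> (norm ((r * a) *\<^sub>R n - (l' - x)))\<^sup>2 \<le> \<delta>\<^sup>2"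
      unfolding expand using two_balls_cover[OF assms(2,4,5)] by blast
    moreover have "(r * a) *\<^sub>R n - (y - x) = z - y" for y
      using r(3) a(2) by (simp add: algebra_simps)
    ultimately have "norm (z - l) \<le> \<delta> \<or> norm (z - l') \<le> \<delta>"
      using assms(4) by (auto simp: power2_le_iff_abs_le)
    then show ?thesis
      using l(1) l'(1) by (auto simp: dist_norm norm_minus_commute)
  qed
qed

text \<open>The retraction is the nearest-point projection. Its values lie in the compact set
  \<open>X\<close>, so a closed graph gives continuity.\<close>

lemma tubular_retraction:
  fixes X L :: "'a::euclidean_space set"
  assumes "compact X" and reach: "reach_at_least X \<tau>" and "\<tau> > 0" "\<delta> > 0" "\<delta>\<^sup>2 < 3 / 5 * \<tau>\<^sup>2"
    and "L \<subseteq> X" "\<And>p. p \<in> X \<Longrightarrow> \<exists>l\<in>L. norm (p - l) < \<delta> / 2"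
    and U: "U = (\<Union>l\<in>L. cball l \<delta>)"
  obtains \<pi> where "continuous_on U \<pi>" "\<pi> ` U \<subseteq> X" "\<And>x. x \<in> X \<Longrightarrow> \<pi> x = x"
    "\<And>p. p \<in> U \<Longrightarrow> dist p (\<pi> p) \<le> \<delta>" "\<And>p. p \<in> U \<Longrightarrow> closed_segment (\<pi> p) p \<subseteq> U"
proof
  let ?\<pi> = "closest_point X"
  have X: "closed X" using assms(1) by (rule compact_imp_closed)
  have "\<delta>\<^sup>2 < \<tau>\<^sup>2" using assms(5) zero_less_power[OF assms(3), of 2] by linarith
  then have \<delta>\<tau>: "\<delta> < \<tau>" using assms(3) by (simp add: power2_less_imp_less)
  have nearest: "?\<pi> p \<in> X" "y \<in> X \<Longrightarrow> dist p (?\<pi> p) \<le> dist p y" "dist p (?\<pi> p) \<le> \<delta>" if "p \<in> U" for p y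
  proof -
    obtain l where l: "l \<in> X" "dist p l \<le> \<delta>" using \<open>p \<in> U\<close> assms(6) U by (auto simp: dist_commute)
    show "?\<pi> p \<in> X" "y \<in> X \<Longrightarrow> dist p (?\<pi> p) \<le> dist p y"
      using closest_point_exists[OF X, of p] l(1) by auto
    show "dist p (?\<pi> p) \<le> \<delta>"
      using closest_point_exists[OF X, of p] l by force
  qed
  show "?\<pi> ` U \<subseteq> X" using nearest(1) by blast
  show "?\<pi> x = x" if "x \<in> X" for x using that by (rule closest_point_self)
  show "dist p (?\<pi> p) \<le> \<delta>" if "p \<in> U" for p using nearest(3)[OF that] .
  show "closed_segment (?\<pi> p) p \<subseteq> U" if "p \<in> U" for p
    using segment_to_nearest_point[OF reach assms(3) X assms(4-7) nearest(1,2)[OF that]] that U by blast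
  \<comment> \<open>Two nearest points would be feet of two normal vectors of length at most
    \<open>\<delta> < \<tau>\<close> with the same tip.\<close>
  have unique: "x = ?\<pi> p" if "p \<in> U" "x \<in> X" "\<And>y. y \<in> X \<Longrightarrow> dist p x \<le> dist p y" for p x
  proof -
    have "normal_at X x (p - x)" "normal_at X (?\<pi> p) (p - ?\<pi> p)"
      using nearest_point_normal that(3) nearest(2)[OF that(1)] by blast+
    moreover have "norm (p - ?\<pi> p) < \<tau>" "norm (p - x) < \<tau>"
      using nearest(3)[OF that(1)] that(3)[OF nearest(1)[OF that(1)]] \<delta>\<tau> by (auto simp: dist_norm)
    moreover have "x + (p - x) = ?\<pi> p + (p - ?\<pi> p)" by simp
    ultimately show ?thesis
      using reach that(2) nearest(1)[OF that(1)] unfolding reach_at_least_def by blast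
  qed
  \<comment> \<open>By uniqueness, being a nearest point, a closed condition on pairs, describes
    exactly the graph.\<close>
  have graph: "(\<lambda>p. (p, ?\<pi> p)) ` U = (U \<times> X) \<inter> {z. \<forall>y\<in>X. dist (fst z) (snd z) \<le> dist (fst z) y}"
    using nearest unique by (auto simp: image_iff)
  have "closed {z :: 'a \<times> 'a. \<forall>y\<in>X. dist (fst z) (snd z) \<le> dist (fst z) y}"
    unfolding Ball_def
    by (intro closed_Collect_all closed_Collect_imp closed_Collect_le continuous_intros) auto
  then have "closedin (top_of_set (U \<times> X)) ((\<lambda>p. (p, ?\<pi> p)) ` U)"
    unfolding graph by (rule closedin_closed_Int)
  then show "continuous_on U ?\<pi>"
    using continuous_closed_graph_eq[OF assms(1), of ?\<pi> U] nearest(1) by auto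
qed

section \<open>Interleaving\<close>

lemma compact_sublevel:
  assumes "compact Z" "continuous_on UNIV f"
  shows "compact (sublevel Z f u)"
proof -
  have "sublevel Z f u = Z \<inter> (\<Inter>j. {p. f p $ j \<le> u $ j})"
    by (auto simp: sublevel_def vpreceq_def)
  moreover have "closed (\<Inter>j. {p. f p $ j \<le> u $ j})"
    using assms(2) by (intro closed_INT ballI closed_Collect_le continuous_intros) auto
  ultimately show ?thesis using compact_Int_closed[OF assms(1)] by simp
qed

lemma modulus_of_continuity_bound:
  assumes "has_modulus_of_continuity f \<Omega>" "norm (p - p') \<le> \<epsilon>"
  shows "\<bar>f p $ j - f p' $ j\<bar> \<le> \<Omega> \<epsilon>"
proof -
  let ?S = "\<lambda>j. {\<bar>f p $ j - f p' $ j\<bar> |p p'. norm (p - p') \<le> \<epsilon>}"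
  have "\<epsilon> \<ge> 0" using assms(2) norm_ge_zero order_trans by blast
  then have bdd: "bdd_above (?S j)" and \<Omega>: "\<Omega> \<epsilon> = Max (range (\<lambda>j. Sup (?S j)))"
    using assms(1) by (auto simp: has_modulus_of_continuity_def)
  have "\<bar>f p $ j - f p' $ j\<bar> \<le> Sup (?S j)"
    using assms(2) by (intro cSup_upper bdd) auto
  also have "\<dots> \<le> \<Omega> \<epsilon>"
    unfolding \<Omega> by (intro Max_ge) auto
  finally show ?thesis .
qed

lemma sublevel_mono: "Z \<subseteq> Y \<Longrightarrow> u \<preceq> v \<Longrightarrow> sublevel Z f u \<subseteq> sublevel Y f v"
  unfolding sublevel_def vpreceq_def by (fastforce intro: order_trans)

text \<open>For the lower bound, \<open>\<pi>\<close> leads from \<open>U\<close> at level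
  \<open>u - \<omega>\<close> to \<open>X\<close> at \<open>u\<close>, and inclusion from
  \<open>X\<close> at \<open>v\<close> to \<open>U\<close> at \<open>v + \<omega>\<close>; the
  composite is homotopic to an inclusion. For the upper bound inclusion comes first and
  \<open>\<pi>\<close> last, and the composite is an inclusion because \<open>\<pi>\<close> fixes
  \<open>X\<close>.\<close>

lemma pers_betti_interleaving:
  fixes X U :: "'a::euclidean_space set" and f :: "'a \<Rightarrow> real^'n"
  assumes U: "compact U" and XU: "X \<subseteq> U" and f: "continuous_on UNIV f"
    and \<omega>: "\<And>p p'. norm (p - p') \<le> \<delta> \<Longrightarrow> f p \<preceq> f p' + \<omega>"
    and \<pi>: "continuous_on U \<pi>" "\<pi> ` U \<subseteq> X" "\<And>x. x \<in> X \<Longrightarrow> \<pi> x = x"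
    and near: "\<And>p. p \<in> U \<Longrightarrow> dist p (\<pi> p) \<le> \<delta>" and seg: "\<And>p. p \<in> U \<Longrightarrow> closed_segment (\<pi> p) p \<subseteq> U"
  shows pers_betti_interleaving_lower:
      "u \<preceq> v \<Longrightarrow> pers_betti TYPE('k::field) i U f (u - \<omega>, v + \<omega>) \<le> pers_betti TYPE('k) i X f (u, v)"
    and pers_betti_interleaving_upper:
      "u + \<omega> \<preceq> v - \<omega> \<Longrightarrow> pers_betti TYPE('k) i X f (u, v) \<le> pers_betti TYPE('k) i U f (u + \<omega>, v - \<omega>)"
proof -
  \<comment> \<open>The source of all level shifts: a move of length at most \<open>\<delta>\<close>
    raises the level by at most \<open>\<omega>\<close>.\<close>
  have sub: "q \<in> sublevel Z f w'" if "p \<in> sublevel Y f w" "q \<in> Z" "norm (q - p) \<le> \<delta>" "w + \<omega> \<preceq> w'"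
    for p q w w' and Y Z
    unfolding sublevel_def vpreceq_def
  proof (intro CollectI conjI allI)
    fix j
    have "f q $ j \<le> f p $ j + \<omega> $ j" "f p $ j \<le> w $ j" "w $ j + \<omega> $ j \<le> w' $ j"
      using \<omega>[OF that(3)] that(1,4) by (auto simp: sublevel_def vpreceq_def)
    then show "f q $ j \<le> w' $ j" by linarith
  qed (rule that(2))
  have near': "norm (\<pi> p - p) \<le> \<delta>" if "p \<in> U" for p
    using near[OF that] by (simp add: dist_norm norm_minus_commute)
  \<comment> \<open>A point of \<open>U\<close> is what forces \<open>\<delta>\<close>, and with it
    \<open>\<omega>\<close>, to be nonnegative.\<close>
  have \<omega>0: "0 \<preceq> \<omega>" and \<delta>0: "0 \<le> \<delta>" if "p \<in> U" for p
  proof -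
    show "0 \<le> \<delta>" using near[OF that] zero_le_dist order_trans by blast
    then show "0 \<preceq> \<omega>" using \<omega>[of p p] by (simp add: vpreceq_def)
  qed
  show "pers_betti TYPE('k) i U f (u - \<omega>, v + \<omega>) \<le> pers_betti TYPE('k) i X f (u, v)" if uv: "u \<preceq> v"
  proof (rule pers_betti_factor[where g = \<pi> and h = id])
    let ?A = "sublevel U f (u - \<omega>)" and ?B = "sublevel U f (v + \<omega>)"
    have A: "?A \<subseteq> U" by (auto simp: sublevel_def)
    show "continuous_on ?A \<pi>" using \<pi>(1) A by (rule continuous_on_subset)
    show "\<pi> ` ?A \<subseteq> sublevel X f u"
    proof
      fix q assume "q \<in> \<pi> ` ?A"
      then obtain p where p: "p \<in> ?A" "q = \<pi> p" by blast
      then show "q \<in> sublevel X f u"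
        using A \<pi>(2) near' by (intro sub[OF p(1)]) (auto simp: vpreceq_def)
    qed
    show "id ` sublevel X f v \<subseteq> ?B"
    proof
      fix q assume "q \<in> id ` sublevel X f v"
      then have q: "q \<in> sublevel X f v" by simp
      then have "q \<in> U" using XU by (auto simp: sublevel_def)
      then show "q \<in> ?B"
        using \<delta>0 by (intro sub[OF q]) (auto simp: vpreceq_def)
    qed
    show "sublevel X f u \<subseteq> sublevel X f v" using uv by (intro sublevel_mono) auto
    fix x :: "_ \<Rightarrow> (_ \<Rightarrow>\<^sub>0 'k) set"
    assume x: "x \<in> carrier (cech_homology i (top_of_set ?A))"
    \<comment> \<open>The straight-line homotopy from the inclusion to \<open>\<pi>\<close>. It
      stays in \<open>U\<close> by \<open>seg\<close>, and within \<open>\<delta>\<close> of its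
      start, hence below \<open>u\<close> and so below \<open>v + \<omega>\<close>.\<close>
    let ?H = "\<lambda>z::real \<times> 'a. (1 - fst z) *\<^sub>R snd z + fst z *\<^sub>R \<pi> (snd z)"
    have "cech_map i (top_of_set ?A) (top_of_set ?B) (\<lambda>a. ?H (0, a)) x
      = cech_map i (top_of_set ?A) (top_of_set ?B) (\<lambda>a. ?H (1, a)) x"
    proof (rule cech_map_homotopy[OF _ _ _ _ x])
      show "compact ?A" "compact ?B" using compact_sublevel[OF U f] by auto
      show "continuous_on ({0..1} \<times> ?A) ?H"
        using A by (intro continuous_intros continuous_on_compose2[OF \<pi>(1)]) auto
      show "?H ` ({0..1} \<times> ?A) \<subseteq> ?B"
      proof (clarsimp simp del: atLeastAtMost_iff)
        fix t :: real and p assume t: "t \<in> {0..1}" and p: "p \<in> ?A"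
        let ?q = "(1 - t) *\<^sub>R p + t *\<^sub>R \<pi> p"
        have pU: "p \<in> U" using A p by auto
        have q: "?q \<in> closed_segment p (\<pi> p)" using t by (auto simp: in_segment)
        have "norm (?q - p) \<le> \<delta>"
          using dist_in_closed_segment[OF q] near[OF pU] by (simp add: dist_norm norm_minus_commute)
        moreover have "?q \<in> U" using q seg[OF pU] by (auto simp: closed_segment_commute)
        moreover have "u - \<omega> + \<omega> \<preceq> v + \<omega>"
          using uv \<omega>0[OF pU] by (auto simp: vpreceq_def intro: add_increasing2)
        ultimately show "?q \<in> ?B" using sub[OF p] by blast
      qed
    qed
    then show "cech_map i (top_of_set ?A) (top_of_set ?B) id x
      = cech_map i (top_of_set ?A) (top_of_set ?B) (\<lambda>x. id (\<pi> x)) x"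
      by (simp add: id_def)
  qed (simp add: id_def)
  show "pers_betti TYPE('k) i X f (u, v) \<le> pers_betti TYPE('k) i U f (u + \<omega>, v - \<omega>)"
    if uv: "u + \<omega> \<preceq> v - \<omega>"
  proof (rule pers_betti_factor[where g = id and h = \<pi>])
    let ?A = "sublevel X f u" and ?B = "sublevel X f v"
    have A: "?A \<subseteq> X" by (auto simp: sublevel_def)
    show "continuous_on (sublevel U f (v - \<omega>)) \<pi>"
      by (rule continuous_on_subset[OF \<pi>(1)]) (auto simp: sublevel_def)
    show "\<pi> ` sublevel U f (v - \<omega>) \<subseteq> ?B"
    proof
      fix q assume "q \<in> \<pi> ` sublevel U f (v - \<omega>)"
      then obtain p where p: "p \<in> sublevel U f (v - \<omega>)" "q = \<pi> p" by blast
      then have "p \<in> U" by (auto simp: sublevel_def)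
      then show "q \<in> ?B"
        using p(2) \<pi>(2) near' by (intro sub[OF p(1)]) (auto simp: vpreceq_def)
    qed
    show "id ` ?A \<subseteq> sublevel U f (u + \<omega>)"
    proof
      fix q assume "q \<in> id ` ?A"
      then have q: "q \<in> ?A" by simp
      then have "q \<in> U" using XU A by auto
      then show "q \<in> sublevel U f (u + \<omega>)"
        using \<delta>0 by (intro sub[OF q]) (auto simp: vpreceq_def)
    qed
    show "sublevel U f (u + \<omega>) \<subseteq> sublevel U f (v - \<omega>)" using uv by (intro sublevel_mono) auto
    fix x :: "_ \<Rightarrow> (_ \<Rightarrow>\<^sub>0 'k) set"
    assume x: "x \<in> carrier (cech_homology i (top_of_set ?A))"
    have "?A \<subseteq> ?B"
    \<comment> \<open>For empty \<open>X\<close> the sign of \<open>\<omega>\<close> is unknown, but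
      both sublevel sets are empty.\<close>
    proof (cases "X = {}")
      case False
      then have "0 \<preceq> \<omega>" using XU \<omega>0 by blast
      have "u $ j \<le> v $ j" for j
      proof -
        have "u $ j + \<omega> $ j \<le> v $ j - \<omega> $ j" "0 \<le> \<omega> $ j"
          using uv \<open>0 \<preceq> \<omega>\<close> by (auto simp: vpreceq_def)
        then show ?thesis by linarith
      qed
      then show ?thesis by (intro sublevel_mono) (auto simp: vpreceq_def)
    qed (simp add: sublevel_def)
    then show "cech_map i (top_of_set ?A) (top_of_set ?B) id x
      = cech_map i (top_of_set ?A) (top_of_set ?B) (\<lambda>x. \<pi> (id x)) x"
      using \<pi>(3) A by (intro cech_map_cong[OF _ _ x]) (auto simp: image_subset_iff_funcset)
  qed (simp add: id_def)
qed

section \<open>Constancy away from discontinuities\<close>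

text \<open>\<open>infnorm\<close> is a maximum over the standard basis, which here joins the
  coordinate vectors of both factors; so on pairs it is the max norm.\<close>

lemma infnorm_prod_le:
  fixes x :: "real^'n" and y :: "real^'m"
  assumes "\<And>j. \<bar>x $ j\<bar> \<le> r" "\<And>j. \<bar>y $ j\<bar> \<le> r"
  shows "infnorm (x, y) \<le> r"
  unfolding infnorm_Max
  by (subst Max_le_iff)
     (use assms in \<open>auto simp: Basis_prod_def Basis_vec_def inner_axis\<close>)

lemma convex_infnorm_ball: "convex {z. infnorm (w - z) \<le> r}"
proof (rule convexI)
  fix a b :: 'a and s t :: real
  assume ab: "a \<in> {z. infnorm (w - z) \<le> r}" "b \<in> {z. infnorm (w - z) \<le> r}" and st: "0 \<le> s" "0 \<le> t" "s + t = 1"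
  have "w - (s *\<^sub>R a + t *\<^sub>R b) = (s + t) *\<^sub>R w - (s *\<^sub>R a + t *\<^sub>R b)"
    using st(3) by simp
  also have "\<dots> = s *\<^sub>R (w - a) + t *\<^sub>R (w - b)"
    by (simp add: algebra_simps)
  finally have "infnorm (w - (s *\<^sub>R a + t *\<^sub>R b)) \<le> s * infnorm (w - a) + t * infnorm (w - b)"
    using infnorm_triangle[of "s *\<^sub>R (w - a)" "t *\<^sub>R (w - b)"] st(1,2) by (simp add: infnorm_mul)
  also have "\<dots> \<le> s * r + t * r"
    using ab st by (intro add_mono mult_left_mono) auto
  finally show "s *\<^sub>R a + t *\<^sub>R b \<in> {z. infnorm (w - z) \<le> r}"
    using st(3) by (simp flip: distrib_right)
qed

text \<open>Continuity into a discrete space makes \<open>b\<close> locally constant at each point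
  of \<open>K\<close>, and \<open>K\<close> is connected.\<close>

lemma no_discontinuity_imp_constant:
  assumes "connected K" "K \<subseteq> Delta_plus" "\<And>z. z \<in> K \<Longrightarrow> \<not> discontinuity_point b z" "w \<in> K" "z \<in> K"
  shows "b w = b z"
proof (rule connected_equivalence_relation[OF assms(1,4,5), where R = "\<lambda>x y. b x = b y"])
  fix a assume a: "a \<in> K"
  then have "topcontinuous_at (top_of_set Delta_plus) (discrete_topology UNIV) b a"
    using assms(2) assms(3)[OF a] unfolding discontinuity_point_def by blast
  then have "\<forall>V. openin (discrete_topology UNIV) V \<and> b a \<in> V \<longrightarrow>
      (\<exists>T. openin (top_of_set Delta_plus) T \<and> a \<in> T \<and> (\<forall>y\<in>T. b y \<in> V))"
    unfolding topcontinuous_at_def by (elim conjE)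
  from spec[OF this, of "{b a}"]
  have "\<exists>T. openin (top_of_set Delta_plus) T \<and> a \<in> T \<and> (\<forall>y\<in>T. b y = b a)"
    by simp
  then obtain T where T: "openin (top_of_set Delta_plus) T" "a \<in> T" "\<forall>y\<in>T. b y = b a"
    by (elim exE conjE)
  obtain G where G: "open G" "T = Delta_plus \<inter> G"
    using T(1) unfolding openin_open by (elim exE conjE)
  then have "K \<inter> T = K \<inter> G" using assms(2) by auto
  then have "openin (top_of_set K) (K \<inter> T)" using G(1) by (simp add: openin_open_Int)
  moreover have "b a = b x" if "x \<in> K \<inter> T" for x
    using bspec[OF T(3) IntD2[OF that]] by (rule sym)
  ultimately show "\<exists>T. openin (top_of_set K) T \<and> a \<in> T \<and> (\<forall>x\<in>T. b a = b x)"
    using IntI[OF a T(2)] by (intro exI[of _ "K \<inter> T"] conjI ballI)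
qed auto

section \<open>Both statements, from the interleaving and the constancy argument\<close>

theorem mainTheorem1:
  fixes X L U :: "(real^'m) set"
    and f :: "real^'m \<Rightarrow> real^'n"
    and \<Omega> :: "real \<Rightarrow> real"
    and \<tau> \<delta> :: real
    and i :: int
    and \<omega> :: "real^'n"
    and \<beta>\<^sub>X \<beta>\<^sub>U :: "(real^'n) \<times> (real^'n) \<Rightarrow> enat"
  assumes "compact X" and "smooth_submanifold X" and "triangulable_submanifold X"
    and "has_condition_number X (1 / \<tau>)"
    and "continuous_on UNIV f" and "has_modulus_of_continuity f \<Omega>"
    and "0 < \<delta>" and "\<delta> < sqrt (3 / 5) * \<tau>"
    and "finite L" and "L \<subseteq> X" and "\<forall>p\<in>X. \<exists>l\<in>L. norm (p - l) < \<delta> / 2"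
    and "U = (\<Union>l\<in>L. cball l \<delta>)"
    and "\<beta>\<^sub>X = pers_betti TYPE('k::field) i X f"
    and "\<beta>\<^sub>U = pers_betti TYPE('k) i U f"
    and "\<omega> = (\<chi> j. \<Omega> \<delta>)"
  shows "(\<forall>u v. (u, v) \<in> Delta_plus \<and> u + \<omega> \<prec> v - \<omega> \<longrightarrow>
            \<beta>\<^sub>U (u - \<omega>, v + \<omega>) \<le> \<beta>\<^sub>X (u, v) \<and> \<beta>\<^sub>X (u, v) \<le> \<beta>\<^sub>U (u + \<omega>, v - \<omega>)) \<and>
         (\<forall>u v. (u, v) \<in> Delta_plus \<and> \<beta>\<^sub>X (u, v) \<noteq> \<beta>\<^sub>U (u, v) \<longrightarrow>
            (\<exists>u' v'. infnorm ((u, v) - (u', v')) \<le> \<Omega> \<delta> \<and>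
               ((u', v') \<in> frontier Delta_plus \<or> discontinuity_point \<beta>\<^sub>U (u', v'))))"
proof -
  note \<tau> = condition_number_reach[OF assms(4)]
  have "\<delta>\<^sup>2 < (sqrt (3 / 5) * \<tau>)\<^sup>2"
    using assms(7,8) by (intro power_strict_mono) auto
  then have \<delta>: "\<delta>\<^sup>2 < 3 / 5 * \<tau>\<^sup>2"
    by (simp add: power_mult_distrib)
  obtain \<pi> where \<pi>: "continuous_on U \<pi>" "\<pi> ` U \<subseteq> X" "\<And>x. x \<in> X \<Longrightarrow> \<pi> x = x"
    "\<And>p. p \<in> U \<Longrightarrow> dist p (\<pi> p) \<le> \<delta>" "\<And>p. p \<in> U \<Longrightarrow> closed_segment (\<pi> p) p \<subseteq> U"
    using tubular_retraction[OF assms(1) \<tau>(2,1) assms(7) \<delta> assms(10) _ assms(12)] assms(11) by metis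
  have U: "compact U" using assms(9,12) by auto
  have XU: "X \<subseteq> U"
  proof
    fix p assume "p \<in> X"
    then obtain l where "l \<in> L" "norm (p - l) < \<delta> / 2" using assms(11) by blast
    then show "p \<in> U" using assms(7,12) by (force simp: dist_norm norm_minus_commute)
  qed
  have f_near: "f p \<preceq> f p' + \<omega>" if "norm (p - p') \<le> \<delta>" for p p'
    unfolding vpreceq_def
  proof
    fix j
    show "f p $ j \<le> (f p' + \<omega>) $ j"
      using modulus_of_continuity_bound[OF assms(6) that, of j] by (simp add: assms(15))
  qed
  have \<Omega>0: "0 \<le> \<Omega> \<delta>"
    using order_trans[OF abs_ge_zero modulus_of_continuity_bound[OF assms(6), of 0 0 \<delta>]] assms(7) by simp
  have prec_preceq: "u \<preceq> v" if "u \<prec> v" for u v :: "real^'n"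
    using that by (auto simp: vprec_def vpreceq_def less_imp_le)
  have part1: "\<beta>\<^sub>U (u - \<omega>, v + \<omega>) \<le> \<beta>\<^sub>X (u, v) \<and> \<beta>\<^sub>X (u, v) \<le> \<beta>\<^sub>U (u + \<omega>, v - \<omega>)"
    if "(u, v) \<in> Delta_plus" "u + \<omega> \<prec> v - \<omega>" for u v
    using that prec_preceq unfolding assms(13,14)
    by (intro conjI pers_betti_interleaving_lower[OF U XU assms(5) f_near \<pi>]
        pers_betti_interleaving_upper[OF U XU assms(5) f_near \<pi>]) (auto simp: Delta_plus_def)
  have part2: "\<exists>u' v'. infnorm ((u, v) - (u', v')) \<le> \<Omega> \<delta> \<and>
      ((u', v') \<in> frontier Delta_plus \<or> discontinuity_point \<beta>\<^sub>U (u', v'))"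
    if uv: "(u, v) \<in> Delta_plus" and neq: "\<beta>\<^sub>X (u, v) \<noteq> \<beta>\<^sub>U (u, v)" for u v
  proof (rule ccontr)
    assume none: "\<not> ?thesis"
    define K where "K = {z. infnorm ((u, v) - z) \<le> \<Omega> \<delta>}"
    have K: "connected K" unfolding K_def by (intro convex_connected convex_infnorm_ball)
    \<comment> \<open>Shifting by \<open>\<omega>\<close> changes every coordinate by
      \<open>\<Omega> \<delta>\<close>, so the two points whose values squeeze
      \<open>\<beta>\<^sub>X\<close> lie in the ball.\<close>
    have mem: "(u, v) \<in> K" "(u - \<omega>, v + \<omega>) \<in> K" "(u + \<omega>, v - \<omega>) \<in> K"
      using \<Omega>0 by (auto simp: K_def assms(15) infnorm_0 simp flip: zero_prod_def intro!: infnorm_prod_le)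
    have "K \<inter> frontier Delta_plus = {}" using none by (auto simp: K_def)
    \<comment> \<open>A connected set that meets \<open>Delta_plus\<close> and avoids its frontier
      cannot leave it.\<close>
    then have sub: "K \<subseteq> Delta_plus"
      using connected_Int_frontier[OF K, of Delta_plus] mem(1) uv by blast
    have const: "\<beta>\<^sub>U z = \<beta>\<^sub>U (u, v)" if "z \<in> K" for z
      using none by (intro no_discontinuity_imp_constant[OF K sub _ that mem(1)]) (auto simp: K_def)
    \<comment> \<open>Membership of the inward-shifted point in \<open>Delta_plus\<close> is exactly
      the condition under which the first statement applies.\<close>
    have "u + \<omega> \<prec> v - \<omega>" using sub mem(3) by (auto simp: Delta_plus_def)
    from part1[OF uv this] show False
      using const[OF mem(2)] const[OF mem(3)] neq order.antisym by auto
  qed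
  show ?thesis using part1 part2 by blast
qed

end
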